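(* Consider the half-duplex bi-directional relay channel under the $(m,2)$ MABC protocol described in the context, with durations $\Delta_1,\Delta_2\ge0$, $\Delta_1+\Delta_2=1$. If $(R_a,R_b)$ is achievable, then there exist a random variable $Q$ on a finite set with $|\mathcal Q|\le 2^{m+1}$ and a joint distribution $p(q)p^{(1)}(x_a|q)p^{(1)}(x_b|q)p^{(1)}(y_{\mathcal R}|x_a,x_b)p^{(2)}(x_{\mathcal R})p^{(2)}(y_a,y_b|x_{\mathcal R})$ such that for every $S_R\subseteq\mathcal R$, with $\bar S_R=\mathcal R\setminus S_R$, $$R_a\le\Delta_1 I(X_a^{(1)};Y_{\bar S_R}^{(1)}|X_b^{(1)},Q)+\Delta_2 I(X_{S_R}^{(2)};Y_b^{(2)}|X_{\bar S_R}^{(2)}),$$ $$R_b\le\Delta_1 I(X_b^{(1)};Y_{\bar S_R}^{(1)}|X_a^{(1)},Q)+\Delta_2 I(X_{S_R}^{(2)};Y_a^{(2)}|X_{\bar S_R}^{(2)}).$$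
   Context: Network: terminals $a,b$ and relays $\mathcal R=\{r_1,\dots,r_m\}$. Each node $r$ has finite input alphabet $\mathcal X_r$ and output alphabet $\mathcal Y_r$; $\varnothing$ means no input/no output, and variables equal to $\varnothing$ are dropped from information quantities (mutual information with an empty variable set is $0$). The $(m,2)$ MABC protocol: phase 1, $a$ and $b$ transmit and all relays receive through the discrete memoryless channel $p^{(1)}(y_{\mathcal R}|x_a,x_b)$; phase 2, all relays transmit and $a,b$ receive through $p^{(2)}(y_a,y_b|x_{\mathcal R})$. $X_S^{(\ell)},Y_S^{(\ell)}$ denote inputs/outputs of the nodes in $S$ in a generic use of phase $\ell$. Messages $W_a$ (at $a$, wanted at $b$) and $W_b$ (at $b$, wanted at $a$) are independent, uniform on $\{0,\dots,\lfloor2^{nR_a}\rfloor-1\}$, $\{0,\dots,\lfloor2^{nR_b}\rfloor-1\}$. A code of length $n$ assigns $n_\ell$ channel uses to phase $\ell$; each transmitter's input at time $k$ is a function of its own message (if any) and its past outputs; $a$ decodes $\tilde W_b$ from its outputs and $W_a$, and $b$ decodes $\tilde W_a$ similarly. $(R_a,R_b)$ is achievable for durations $(\Delta_\ell)$ if there are codes with $n_\ell/n\to\Delta_\ell$ and both error probabilities $\to0$. *)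

theory Defs
  imports "HOL-Probability.Probability_Mass_Function" "HOL-Library.FuncSet"
begin

definition cmi :: "'w pmf \<Rightarrow> ('w \<Rightarrow> 'x) \<Rightarrow> ('w \<Rightarrow> 'y) \<Rightarrow> ('w \<Rightarrow> 'z) \<Rightarrow> real" where
  "cmi p X Y Z =
     (let pxyz = map_pmf (\<lambda>w. (X w, Y w, Z w)) p;
          pxz = map_pmf (\<lambda>w. (X w, Z w)) p;
          pyz = map_pmf (\<lambda>w. (Y w, Z w)) p;
          pz = map_pmf Z p
      in (\<Sum>(x, y, z) \<in> set_pmf pxyz.
            pmf pxyz (x, y, z) *
            log 2 (pmf pxyz (x, y, z) * pmf pz z / (pmf pxz (x, z) * pmf pyz (y, z)))))"

fun seq_pmf :: "'a pmf list \<Rightarrow> 'a list pmf" where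
  "seq_pmf [] = return_pmf []"
| "seq_pmf (p # ps) = bind_pmf p (\<lambda>x. map_pmf (\<lambda>xs. x # xs) (seq_pmf ps))"

(* An (m,2) MABC code. Relays are 0..m-1.
   Phase 1: times k < c_n1; a sends enc_a W_a k, b sends enc_b W_b k.
   Phase 2: times k < c_n2; relay r sends relay_enc r k (its phase-1 outputs).
   a decodes W_b from (W_a, its phase-2 outputs); b decodes W_a likewise. *)
record ('xa, 'xb, 'xr, 'yr, 'ya, 'yb) mabc_code =
  c_n1 :: nat
  c_n2 :: nat
  enc_a :: "nat \<Rightarrow> nat \<Rightarrow> 'xa"
  enc_b :: "nat \<Rightarrow> nat \<Rightarrow> 'xb"
  relay_enc :: "nat \<Rightarrow> nat \<Rightarrow> 'yr list \<Rightarrow> 'xr"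
  dec_a :: "nat \<Rightarrow> 'ya list \<Rightarrow> nat"
  dec_b :: "nat \<Rightarrow> 'yb list \<Rightarrow> nat"

definition msg_size :: "nat \<Rightarrow> real \<Rightarrow> nat" where
  "msg_size n R = nat \<lfloor>2 powr (real n * R)\<rfloor>"

definition mabc_run ::
  "nat \<Rightarrow> ('xa \<Rightarrow> 'xb \<Rightarrow> (nat \<Rightarrow> 'yr) pmf) \<Rightarrow> ((nat \<Rightarrow> 'xr) \<Rightarrow> ('ya \<times> 'yb) pmf)
   \<Rightarrow> nat \<Rightarrow> nat \<Rightarrow> ('xa, 'xb, 'xr, 'yr, 'ya, 'yb) mabc_code \<Rightarrow> (nat \<times> nat \<times> nat \<times> nat) pmf" where
  "mabc_run m p1 p2 Ma Mb c =
     bind_pmf (pmf_of_set {..<Ma}) (\<lambda>wa.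
     bind_pmf (pmf_of_set {..<Mb}) (\<lambda>wb.
     bind_pmf (seq_pmf (map (\<lambda>k. p1 (enc_a c wa k) (enc_b c wb k)) [0..<c_n1 c])) (\<lambda>ys1.
     bind_pmf (seq_pmf (map (\<lambda>k. p2 (\<lambda>r. if r < m then relay_enc c r k (map (\<lambda>y. y r) ys1)
                                            else undefined)) [0..<c_n2 c])) (\<lambda>ys2.
     return_pmf (wa, wb, dec_b c wb (map snd ys2), dec_a c wa (map fst ys2))))))"

definition valid_mabc_code ::
  "nat \<Rightarrow> 'xa set \<Rightarrow> 'xb set \<Rightarrow> (nat \<Rightarrow> 'xr set) \<Rightarrow> nat
   \<Rightarrow> ('xa, 'xb, 'xr, 'yr, 'ya, 'yb) mabc_code \<Rightarrow> bool" where
  "valid_mabc_code m Xa Xb Xr n c \<longleftrightarrow>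
     c_n1 c + c_n2 c = n \<and>
     (\<forall>w k. enc_a c w k \<in> Xa) \<and> (\<forall>w k. enc_b c w k \<in> Xb) \<and>
     (\<forall>r<m. \<forall>k ys. relay_enc c r k ys \<in> Xr r)"

definition mabc_achievable ::
  "nat \<Rightarrow> 'xa set \<Rightarrow> 'xb set \<Rightarrow> (nat \<Rightarrow> 'xr set)
   \<Rightarrow> ('xa \<Rightarrow> 'xb \<Rightarrow> (nat \<Rightarrow> 'yr) pmf) \<Rightarrow> ((nat \<Rightarrow> 'xr) \<Rightarrow> ('ya \<times> 'yb) pmf)
   \<Rightarrow> real \<Rightarrow> real \<Rightarrow> real \<Rightarrow> real \<Rightarrow> bool" where
  "mabc_achievable m Xa Xb Xr p1 p2 \<Delta>1 \<Delta>2 Ra Rb \<longleftrightarrow>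
     0 \<le> Ra \<and> 0 \<le> Rb \<and>
     (\<exists>C :: nat \<Rightarrow> ('xa, 'xb, 'xr, 'yr, 'ya, 'yb) mabc_code.
        (\<forall>n. valid_mabc_code m Xa Xb Xr n (C n)) \<and>
        (\<lambda>n. real (c_n1 (C n)) / real n) \<longlonglongrightarrow> \<Delta>1 \<and>
        (\<lambda>n. real (c_n2 (C n)) / real n) \<longlonglongrightarrow> \<Delta>2 \<and>
        (\<lambda>n. measure_pmf.prob (mabc_run m p1 p2 (msg_size n Ra) (msg_size n Rb) (C n))
                 {(wa, wb, wa', wb'). wa' \<noteq> wa}) \<longlonglongrightarrow> 0 \<and>
        (\<lambda>n. measure_pmf.prob (mabc_run m p1 p2 (msg_size n Ra) (msg_size n Rb) (C n))
                 {(wa, wb, wa', wb'). wb' \<noteq> wb}) \<longlonglongrightarrow> 0)"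

definition phase1_dist ::
  "'q pmf \<Rightarrow> ('q \<Rightarrow> 'xa pmf) \<Rightarrow> ('q \<Rightarrow> 'xb pmf) \<Rightarrow> ('xa \<Rightarrow> 'xb \<Rightarrow> (nat \<Rightarrow> 'yr) pmf)
   \<Rightarrow> ('q \<times> 'xa \<times> 'xb \<times> (nat \<Rightarrow> 'yr)) pmf" where
  "phase1_dist q pxa pxb p1 =
     bind_pmf q (\<lambda>t. bind_pmf (pxa t) (\<lambda>xa. bind_pmf (pxb t) (\<lambda>xb.
       map_pmf (\<lambda>y. (t, xa, xb, y)) (p1 xa xb))))"

definition phase2_dist ::
  "(nat \<Rightarrow> 'xr) pmf \<Rightarrow> ((nat \<Rightarrow> 'xr) \<Rightarrow> ('ya \<times> 'yb) pmf) \<Rightarrow> ((nat \<Rightarrow> 'xr) \<times> 'ya \<times> 'yb) pmf" where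
  "phase2_dist px p2 = bind_pmf px (\<lambda>x. map_pmf (\<lambda>(ya, yb). (x, ya, yb)) (p2 x))"

end

(*
  Single-letterization of the cut-set bound. For a cut S, Fano's inequality bounds log M_a by the
  information that b's side of the cut, (Y_b^n2, Y_{R-S}^n1), carries about W_a given W_b. All upper bounds
  on conditional entropies come from one Gibbs inequality H(X|Y) <= E[-log K(X|Y)], valid for every
  kernel K: a product kernel splits the block into single channel uses, and in phase 2 taking the same
  conditional law of the time-averaged channel for every use replaces the usual concavity argument. In
  phase 1 the time index becomes Q; Caratheodory's argument shrinks its support to at most 2^(m+1)
  points, as there are 2 * (2^m - 1) non-trivial functionals (the cut S = R contributes 0). With a fixed
  finite alphabet for Q the distributions range over a compact set on which the information quantities
  are continuous, so a convergent subsequence gives the claim.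
*)

theory Submission
  imports Defs "HOL-Real_Asymp.Real_Asymp"
begin

section \<open>Entropy and the Gibbs inequality\<close>

text \<open>The two phases are single-lettered differently because the target distributions differ
  in shape. In phase 1 the inputs of \<open>a\<close> and \<open>b\<close> must stay independent
  given \<open>Q\<close>; averaging product laws over time gives no product law, so every channel
  use keeps its own pair of input laws and the time index survives as \<open>Q\<close>. In phase 2
  any joint law of the relay inputs is allowed, so the uses can be merged into one law and no second
  time-sharing variable arises. One choice of laws must serve all cuts and both directions. The
  averaged relay input does not depend on the cut, and the reduction of \<open>Q\<close> preserves
  all functionals at once; it applies because information conditioned on \<open>Q\<close> is linear
  in the law of \<open>Q\<close>. The bounded alphabet is also what the limit needs: the time index
  of a code takes a number of values that grows with the length, and only after the reduction do the
  laws for all lengths live on one finite set. The limit is taken factor by factor, so that it keeps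
  the required product form.\<close>

abbreviation expect :: "'w pmf \<Rightarrow> ('w \<Rightarrow> real) \<Rightarrow> real" where
  "expect p f \<equiv> measure_pmf.expectation p f"

lemma expect_finite:
  assumes "finite (set_pmf p)"
  shows "expect p f = (\<Sum>w\<in>set_pmf p. pmf p w * f w)"
  using integral_measure_pmf_real[of "set_pmf p" p f] assms by (simp add: mult.commute)

lemma expect_superset:
  assumes "finite A" "set_pmf p \<subseteq> A"
  shows "expect p f = (\<Sum>w\<in>A. pmf p w * f w)"
  using integral_measure_pmf_real[of A p f] assms by (auto simp: mult.commute)

lemma expect_cong:
  assumes "\<And>w. w \<in> set_pmf p \<Longrightarrow> f w = g w"
  shows "expect p f = expect p g"
  using assms by (intro integral_cong_AE) (auto simp: AE_measure_pmf_iff)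

lemma expect_mono:
  assumes "finite (set_pmf p)" "\<And>w. w \<in> set_pmf p \<Longrightarrow> f w \<le> g w"
  shows "expect p f \<le> expect p g"
  using assms by (auto simp: expect_finite intro!: sum_mono mult_left_mono)

lemma expect_add:
  assumes "finite (set_pmf p)"
  shows "expect p (\<lambda>w. f w + g w) = expect p f + expect p g"
  using assms by (simp add: expect_finite algebra_simps sum.distrib)

lemma expect_diff:
  assumes "finite (set_pmf p)"
  shows "expect p (\<lambda>w. f w - g w) = expect p f - expect p g"
  using assms by (simp add: expect_finite algebra_simps sum_subtractf)

lemma expect_sum:
  assumes "finite (set_pmf p)"
  shows "expect p (\<lambda>w. \<Sum>i\<in>I. f i w) = (\<Sum>i\<in>I. expect p (f i))"
  using assms by (simp add: expect_finite sum_distrib_left sum.swap[of _ _ I])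

lemma expect_bind:
  assumes "finite (set_pmf p)" "\<And>x. x \<in> set_pmf p \<Longrightarrow> finite (set_pmf (f x))"
  shows "expect (bind_pmf p f) h = expect p (\<lambda>x. expect (f x) h)"
  using pmf_expectation_bind[of "set_pmf p" f p h] assms by (simp add: expect_finite[of p])

lemma prob_map_eq: "pmf (map_pmf X p) (X w) = measure_pmf.prob p {v. X v = X w}"
  by (simp add: pmf_map vimage_def)

lemma prob_cong_supp:
  assumes "\<And>w. w \<in> set_pmf p \<Longrightarrow> w \<in> A \<longleftrightarrow> w \<in> B"
  shows "measure_pmf.prob p A = measure_pmf.prob p B"
  using assms by (intro measure_pmf.finite_measure_eq_AE) (auto simp: AE_measure_pmf_iff)

text \<open>Surprisal is written through the level set of \<open>X\<close>, so that entropy visibly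
  depends only on the partition that \<open>X\<close> induces on the support. Regrouping tuples or
  replacing a variable by an equivalent one then costs one use of \<open>entropy_cong\<close>,
  whatever the codomain types.\<close>

definition entropy :: "'w pmf \<Rightarrow> ('w \<Rightarrow> 'x) \<Rightarrow> real" where
  "entropy p X = expect p (\<lambda>w. - log 2 (measure_pmf.prob p {v. X v = X w}))"

definition cond_entropy :: "'w pmf \<Rightarrow> ('w \<Rightarrow> 'x) \<Rightarrow> ('w \<Rightarrow> 'y) \<Rightarrow> real" where
  "cond_entropy p X Y = entropy p (\<lambda>w. (X w, Y w)) - entropy p Y"

lemma entropy_eq_pmf: "entropy p X = expect p (\<lambda>w. - log 2 (pmf (map_pmf X p) (X w)))"
  by (simp only: entropy_def prob_map_eq)

lemma entropy_cong:
  assumes "\<And>v w. v \<in> set_pmf p \<Longrightarrow> w \<in> set_pmf p \<Longrightarrow> X v = X w \<longleftrightarrow> Y v = Y w"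
  shows "entropy p X = entropy p Y"
  unfolding entropy_def
  by (intro expect_cong arg_cong[where f = uminus] arg_cong2[where f = log] prob_cong_supp)
    (use assms in auto)

lemma cond_entropy_cong:
  assumes "\<And>v w. v \<in> set_pmf p \<Longrightarrow> w \<in> set_pmf p \<Longrightarrow> X v = X w \<longleftrightarrow> X' v = X' w"
    and "\<And>v w. v \<in> set_pmf p \<Longrightarrow> w \<in> set_pmf p \<Longrightarrow> Y v = Y w \<longleftrightarrow> Y' v = Y' w"
  shows "cond_entropy p X Y = cond_entropy p X' Y'"
  unfolding cond_entropy_def
  by (intro arg_cong2[where f = minus] entropy_cong) (use assms in auto)

lemma cond_entropy_chain:
  "cond_entropy p (\<lambda>w. (X w, Y w)) Z =
     cond_entropy p X Z + cond_entropy p Y (\<lambda>w. (X w, Z w))"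
proof -
  have "entropy p (\<lambda>w. ((X w, Y w), Z w)) = entropy p (\<lambda>w. (Y w, X w, Z w))"
    by (rule entropy_cong) auto
  then show ?thesis
    by (simp add: cond_entropy_def)
qed

text \<open>All four marginals are positive on the support, so the logarithm of the ratio splits
  into four surprisals.\<close>

lemma cmi_eq_entropy:
  assumes "finite (set_pmf p)"
  shows "cmi p X Y Z = entropy p (\<lambda>w. (X w, Z w)) + entropy p (\<lambda>w. (Y w, Z w))
           - entropy p (\<lambda>w. (X w, Y w, Z w)) - entropy p Z"
proof -
  let ?P = "\<lambda>V w. pmf (map_pmf V p) (V w)"
  let ?xyz = "\<lambda>w. (X w, Y w, Z w)" and ?xz = "\<lambda>w. (X w, Z w)" and ?yz = "\<lambda>w. (Y w, Z w)"
  have pos: "?P V w > 0" if "w \<in> set_pmf p" for w and V :: "_ \<Rightarrow> 'v"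
    using that by (simp add: pmf_positive_iff)
  have "cmi p X Y Z = expect (map_pmf ?xyz p) (\<lambda>(x, y, z).
      log 2 (pmf (map_pmf ?xyz p) (x, y, z) * pmf (map_pmf Z p) z /
        (pmf (map_pmf ?xz p) (x, z) * pmf (map_pmf ?yz p) (y, z))))"
    using assms by (subst expect_finite) (auto simp: cmi_def Let_def intro!: sum.cong)
  also have "\<dots> = expect p (\<lambda>w. log 2 (?P ?xyz w * ?P Z w / (?P ?xz w * ?P ?yz w)))"
    by simp
  also have "\<dots> = expect p (\<lambda>w. (- log 2 (?P ?xz w) + - log 2 (?P ?yz w)) - - log 2 (?P ?xyz w)
                      - - log 2 (?P Z w))"
  proof (rule expect_cong)
    fix w assume w: "w \<in> set_pmf p"
    show "log 2 (?P ?xyz w * ?P Z w / (?P ?xz w * ?P ?yz w)) =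
        - log 2 (?P ?xz w) + - log 2 (?P ?yz w) - - log 2 (?P ?xyz w) - - log 2 (?P Z w)"
      using pos[OF w, of ?xyz] pos[OF w, of ?xz] pos[OF w, of ?yz] pos[OF w, of Z]
      by (simp add: log_mult log_divide)
  qed
  also have "\<dots> = entropy p ?xz + entropy p ?yz - entropy p ?xyz - entropy p Z"
    unfolding entropy_eq_pmf using assms by (simp only: expect_add expect_diff)
  finally show ?thesis .
qed

lemma cmi_eq_cond_entropy:
  assumes "finite (set_pmf p)"
  shows "cmi p X Y Z = cond_entropy p Y Z - cond_entropy p Y (\<lambda>w. (X w, Z w))"
proof -
  have "entropy p (\<lambda>w. (X w, Y w, Z w)) = entropy p (\<lambda>w. (Y w, X w, Z w))"
    by (rule entropy_cong) auto
  then show ?thesis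
    using assms by (simp add: cmi_eq_entropy cond_entropy_def)
qed

text \<open>Symmetry of conditional mutual information. It turns what the outputs reveal about a
  message into what the message reveals about the outputs, where the channel law is
  available.\<close>

lemma cond_entropy_diff_swap:
  "cond_entropy p X Z - cond_entropy p X (\<lambda>w. (Y w, Z w)) =
   cond_entropy p Y Z - cond_entropy p Y (\<lambda>w. (X w, Z w))"
proof -
  have "entropy p (\<lambda>w. (X w, Y w, Z w)) = entropy p (\<lambda>w. (Y w, X w, Z w))"
    by (rule entropy_cong) auto
  then show ?thesis
    by (simp add: cond_entropy_def)
qed

lemma cmi_map: "cmi (map_pmf f p) X Y Z = cmi p (\<lambda>w. X (f w)) (\<lambda>w. Y (f w)) (\<lambda>w. Z (f w))"
  by (simp add: cmi_def map_pmf_comp)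

lemma cmi_const:
  assumes "finite (set_pmf p)"
  shows "cmi p X (\<lambda>_. c) Z = 0"
proof -
  have "entropy p (\<lambda>w. (c, Z w)) = entropy p Z"
    by (rule entropy_cong) auto
  moreover have "entropy p (\<lambda>w. (X w, c, Z w)) = entropy p (\<lambda>w. (X w, Z w))"
    by (rule entropy_cong) auto
  ultimately show ?thesis
    using assms by (simp add: cmi_eq_entropy)
qed

section \<open>Cross-entropy bounds by kernels\<close>

text \<open>Follows from ln x \<le> x - 1 at the ratio of \<open>q\<close> to \<open>p\<close>,
  since \<open>q\<close> has mass at most 1 on the support of \<open>p\<close>. Positivity of
  \<open>q\<close> there excludes infinite divergence, which a real-valued logarithm cannot
  express.\<close>

lemma gibbs_inequality:
  assumes fin: "finite (set_pmf p)" and pos: "\<And>x. x \<in> set_pmf p \<Longrightarrow> pmf q x > 0"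
  shows "expect p (\<lambda>x. - log 2 (pmf p x)) \<le> expect p (\<lambda>x. - log 2 (pmf q x))"
proof -
  have "expect p (\<lambda>x. - log 2 (pmf p x)) - expect p (\<lambda>x. - log 2 (pmf q x)) =
      expect p (\<lambda>x. log 2 (pmf q x / pmf p x))"
    unfolding expect_diff[OF fin, symmetric]
    using pos by (intro expect_cong) (force simp: log_divide dest: pmf_positive)
  also have "\<dots> \<le> expect p (\<lambda>x. (pmf q x / pmf p x - 1) / ln 2)"
    using pos fin
    by (intro expect_mono) (auto simp: log_def pmf_positive intro!: divide_right_mono ln_le_minus_one)
  also have "\<dots> = (\<Sum>x\<in>set_pmf p. (pmf q x - pmf p x) / ln 2)"
    unfolding expect_finite[OF fin]
    by (intro sum.cong refl) (simp add: pmf_positive[THEN less_imp_neq[THEN not_sym]] set_pmf_iff field_simps)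
  also have "\<dots> = ((\<Sum>x\<in>set_pmf p. pmf q x) - 1) / ln 2"
    by (simp add: sum_divide_distrib[symmetric] sum_subtractf sum_pmf_eq_1 fin)
  also have "\<dots> \<le> 0"
    using measure_pmf.prob_le_1[of q "set_pmf p"] fin
    by (simp add: measure_measure_pmf_finite divide_le_0_iff)
  finally show ?thesis by simp
qed

text \<open>Joint law of a marginal and a kernel, with the kernel's output in the first component to
  match the pair used in \<open>cond_entropy\<close>.\<close>

definition graph_pmf :: "'y pmf \<Rightarrow> ('y \<Rightarrow> 'x pmf) \<Rightarrow> ('x \<times> 'y) pmf" where
  "graph_pmf q K = bind_pmf q (\<lambda>y. map_pmf (\<lambda>x. (x, y)) (K y))"

lemma pmf_graph_pmf: "pmf (graph_pmf q K) (x, y) = pmf q y * pmf (K y) x"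
proof -
  have *: "pmf (map_pmf (\<lambda>x. (x, y')) (K y')) (x, y) = indicator {y} y' * pmf (K y) x" for y'
    by (auto simp: pmf_map vimage_def indicator_def pmf.rep_eq intro: arg_cong)
  show ?thesis
    unfolding graph_pmf_def pmf_bind *
    by (subst integral_measure_pmf_real[of "{y}"]) (auto simp: indicator_def)
qed

text \<open>Gibbs compares the true joint law with the law that has the same
  \<open>Y\<close>-marginal but uses \<open>K\<close> as conditional law. The marginal contributes
  \<open>entropy p Y\<close> to both sides and cancels.\<close>

lemma cond_entropy_le_kernel:
  assumes fin: "finite (set_pmf p)" and pos: "\<And>w. w \<in> set_pmf p \<Longrightarrow> pmf (K (Y w)) (X w) > 0"
  shows "cond_entropy p X Y \<le> expect p (\<lambda>w. - log 2 (pmf (K (Y w)) (X w)))"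
proof -
  let ?P = "map_pmf (\<lambda>w. (X w, Y w)) p" and ?Q = "graph_pmf (map_pmf Y p) K"
  have posY: "pmf (map_pmf Y p) (Y w) > 0" if "w \<in> set_pmf p" for w
    using that by (simp add: pmf_positive_iff)
  have posQ: "pmf ?Q z > 0" if "z \<in> set_pmf ?P" for z
    using that posY pos by (auto simp: pmf_graph_pmf)
  have "entropy p (\<lambda>w. (X w, Y w)) = expect ?P (\<lambda>z. - log 2 (pmf ?P z))"
    by (simp add: entropy_eq_pmf)
  also have "\<dots> \<le> expect ?P (\<lambda>z. - log 2 (pmf ?Q z))"
    by (rule gibbs_inequality) (use fin posQ in auto)
  also have "\<dots> = expect p (\<lambda>w. - log 2 (pmf (map_pmf Y p) (Y w)) + - log 2 (pmf (K (Y w)) (X w)))"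
    unfolding integral_map_pmf
    by (rule expect_cong) (use posY pos in \<open>force simp: pmf_graph_pmf log_mult\<close>)
  also have "\<dots> = entropy p Y + expect p (\<lambda>w. - log 2 (pmf (K (Y w)) (X w)))"
    unfolding expect_add[OF fin] by (simp add: entropy_eq_pmf)
  finally show ?thesis by (simp add: cond_entropy_def)
qed

text \<open>The equality case, for a true conditional law. It is used with channels, whose kernel is
  known by construction, and with \<open>cond_kernel\<close>; the second conclusion supplies the
  positivity that the Gibbs bound asks for.\<close>

lemma cond_entropy_eq_kernel:
  assumes fin: "finite (set_pmf p)" and K: "map_pmf (\<lambda>w. (X w, Y w)) p = graph_pmf (map_pmf Y p) K"
  shows "cond_entropy p X Y = expect p (\<lambda>w. - log 2 (pmf (K (Y w)) (X w)))"
    and "\<And>w. w \<in> set_pmf p \<Longrightarrow> pmf (K (Y w)) (X w) > 0"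
proof -
  have eq: "pmf (map_pmf (\<lambda>w. (X w, Y w)) p) (X w, Y w) = pmf (map_pmf Y p) (Y w) * pmf (K (Y w)) (X w)"
    for w
    by (simp add: K pmf_graph_pmf)
  have pos: "pmf (map_pmf Y p) (Y w) > 0" "pmf (map_pmf (\<lambda>w. (X w, Y w)) p) (X w, Y w) > 0"
    if "w \<in> set_pmf p" for w
    using that by (auto simp: pmf_positive_iff)
  show posK: "pmf (K (Y w)) (X w) > 0" if "w \<in> set_pmf p" for w
    using pos[OF that] unfolding eq by (simp add: zero_less_mult_iff)
  have "cond_entropy p X Y = expect p (\<lambda>w. - log 2 (pmf (map_pmf (\<lambda>w. (X w, Y w)) p) (X w, Y w))
      - - log 2 (pmf (map_pmf Y p) (Y w)))"
    unfolding expect_diff[OF fin]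
    by (simp add: cond_entropy_def entropy_eq_pmf)
  also have "\<dots> = expect p (\<lambda>w. - log 2 (pmf (K (Y w)) (X w)))"
    by (rule expect_cong) (use pos(1) posK in \<open>force simp: eq log_mult\<close>)
  finally show "cond_entropy p X Y = expect p (\<lambda>w. - log 2 (pmf (K (Y w)) (X w)))" .
qed

text \<open>For \<open>y\<close> of probability 0 the conditional law is unspecified; in
  \<open>graph_pmf\<close> such \<open>y\<close> get weight 0.\<close>

definition cond_kernel :: "'w pmf \<Rightarrow> ('w \<Rightarrow> 'x) \<Rightarrow> ('w \<Rightarrow> 'y) \<Rightarrow> 'y \<Rightarrow> 'x pmf" where
  "cond_kernel p X Y y = map_pmf X (cond_pmf p (Y -` {y}))"

lemma disintegration:
  "map_pmf (\<lambda>w. (X w, Y w)) p = graph_pmf (map_pmf Y p) (cond_kernel p X Y)"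
proof (rule pmf_eqI, clarify)
    fix x y
    let ?B = "Y -` {y}"
    have xy: "pmf (map_pmf (\<lambda>w. (X w, Y w)) p) (x, y) = measure_pmf.prob p (X -` {x} \<inter> ?B)"
      unfolding pmf_map by (rule prob_cong_supp) auto
    show "pmf (map_pmf (\<lambda>w. (X w, Y w)) p) (x, y) = pmf (graph_pmf (map_pmf Y p) (cond_kernel p X Y)) (x, y)"
    proof (cases "set_pmf p \<inter> ?B = {}")
      case True
      then have "measure_pmf.prob p ?B = 0" "measure_pmf.prob p (X -` {x} \<inter> ?B) = 0"
        unfolding measure_pmf_zero_iff by auto
      then show ?thesis
        by (simp add: xy pmf_graph_pmf pmf_map[of Y])
    next
      case False
      have "measure_pmf (cond_pmf p ?B) = uniform_measure (measure_pmf p) ?B"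
        using False by (rule cond_pmf.rep_eq)
      then have "measure_pmf.prob (cond_pmf p ?B) (X -` {x}) =
          measure_pmf.prob p (?B \<inter> X -` {x}) / measure_pmf.prob p ?B"
        using False by (simp add: measure_uniform_measure emeasure_measure_pmf_not_zero)
      moreover have "measure_pmf.prob p ?B \<noteq> 0"
        using False by (simp add: measure_pmf_zero_iff)
      ultimately show ?thesis
        unfolding xy pmf_graph_pmf cond_kernel_def by (simp add: pmf_map Int_commute del: map_pmf_comp)
    qed
qed

text \<open>The conditional law given the coarser observation \<open>g (Y w)\<close> is an
  admissible kernel for the finer observation, so Gibbs yields that conditioning on more cannot
  raise the entropy.\<close>

lemma cond_entropy_coarsen:
  assumes "finite (set_pmf p)"
  shows "cond_entropy p X Y \<le> cond_entropy p X (\<lambda>w. g (Y w))"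
proof -
  note K = cond_entropy_eq_kernel[OF assms disintegration[of X "\<lambda>w. g (Y w)" p]]
  show ?thesis
    unfolding K(1)
    by (rule cond_entropy_le_kernel[OF assms, where K = "\<lambda>y. cond_kernel p X (\<lambda>w. g (Y w)) (g y)"])
      (use K(2) in blast)
qed

section \<open>Fano inequality and memoryless blocks\<close>

lemma pmf_of_set_lessThan:
  assumes "(M::nat) > 0"
  shows "set_pmf (pmf_of_set {..<M}) = {..<M}"
    and "pmf (pmf_of_set {..<M}) w = (if w < M then 1 / real M else 0)"
proof -
  have "{..<M} \<noteq> {}"
    using assms by auto
  then show "set_pmf (pmf_of_set {..<M}) = {..<M}"
    and "pmf (pmf_of_set {..<M}) w = (if w < M then 1 / real M else 0)"
    by (auto simp: indicator_def)
qed

lemma fano_inequality: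
  assumes fin: "finite (set_pmf p)" and M: "M > 0"
    and W: "\<And>w. w \<in> set_pmf p \<Longrightarrow> W w < M"
  shows "cond_entropy p W Y \<le> 1 + measure_pmf.prob p {w. d (Y w) \<noteq> W w} * log 2 (real M)"
proof -
  \<comment> \<open>Half of the mass on the guess, half uniform: gives the constant 1 without the binary entropy of the error.\<close>
  define K where "K y = bind_pmf (bernoulli_pmf (1/2))
      (\<lambda>b. if b then return_pmf (d y) else pmf_of_set {..<M})" for y
  have K: "pmf (K (Y w)) (W w) = (if d (Y w) = W w then 1/2 else 0) + 1 / (2 * real M)"
    if "w \<in> set_pmf p" for w
    using W[OF that] M unfolding K_def pmf_bind
    by (subst integral_measure_pmf_real[of UNIV]) (auto simp: UNIV_bool indicator_def pmf_of_set_lessThan)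
  have "cond_entropy p W Y \<le> expect p (\<lambda>w. - log 2 (pmf (K (Y w)) (W w)))"
    by (rule cond_entropy_le_kernel[OF fin]) (use K M in \<open>auto simp: add_pos_pos\<close>)
  \<comment> \<open>A correct guess costs at most one bit through the half placed on it; a wrong one
    has only the uniform half and costs one bit more than \<open>log 2 M\<close>.\<close>
  also have "\<dots> \<le> expect p (\<lambda>w. 1 + indicator {w. d (Y w) \<noteq> W w} w * log 2 (real M))"
  proof (rule expect_mono[OF fin])
    fix w assume w: "w \<in> set_pmf p"
    have "- log 2 (1 / (2 * real M)) = 1 + log 2 (real M)"
      using M by (simp add: log_divide log_mult)
    moreover have "- log 2 (1/2 + 1 / (2 * real M)) \<le> - log 2 (1/2)"
      using M by (simp add: add_pos_pos)
    moreover have "- log 2 (1/2 :: real) = 1"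
      by (simp add: log_divide)
    ultimately show "- log 2 (pmf (K (Y w)) (W w)) \<le> 1 + indicator {w. d (Y w) \<noteq> W w} w * log 2 (real M)"
      using K[OF w] by (auto simp: indicator_def)
  qed
  also have "\<dots> = 1 + measure_pmf.prob p {w. d (Y w) \<noteq> W w} * log 2 (real M)"
    using fin by (simp add: expect_add)
  finally show ?thesis .
qed

text \<open>The law of the two messages, all phase-1 outputs and all phase-2 outputs, without the decoders.\<close>

definition joint_pmf :: "nat \<Rightarrow> nat \<Rightarrow> (nat \<Rightarrow> nat \<Rightarrow> 'u pmf) \<Rightarrow> ('u \<Rightarrow> 'v pmf) \<Rightarrow> (nat \<times> nat \<times> 'u \<times> 'v) pmf" where
  "joint_pmf M1 M2 k1 k2 = bind_pmf (pmf_of_set {..<M1}) (\<lambda>w1. bind_pmf (pmf_of_set {..<M2}) (\<lambda>w2.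
     bind_pmf (k1 w1 w2) (\<lambda>u. map_pmf (\<lambda>v. (w1, w2, u, v)) (k2 u))))"

lemma finite_set_joint_pmf:
  assumes "M1 > 0" "M2 > 0" "\<And>w1 w2. finite (set_pmf (k1 w1 w2))" "\<And>u. finite (set_pmf (k2 u))"
  shows "finite (set_pmf (joint_pmf M1 M2 k1 k2))"
  using assms by (auto simp: joint_pmf_def pmf_of_set_lessThan)

text \<open>\<open>f\<close> and \<open>g\<close> extract what the receiving side of a cut observes.
  The message information is an output entropy given \<open>W2\<close> minus one given both
  messages: the first is bounded above by freely chosen kernels \<open>K\<close> and
  \<open>L\<close>, the second is bounded below by the true channel laws.\<close>

lemma joint_pmf_bound:
  fixes f :: "'u \<Rightarrow> 'a" and g :: "'v \<Rightarrow> 'b" and d :: "nat \<Rightarrow> 'b \<Rightarrow> nat"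
  assumes M: "M1 > 0" "M2 > 0" and fin1: "\<And>w1 w2. finite (set_pmf (k1 w1 w2))"
    and fin2: "\<And>u. finite (set_pmf (k2 u))"
  defines "J \<equiv> joint_pmf M1 M2 k1 k2"
  assumes posK: "\<And>w1 w2 u v. (w1, w2, u, v) \<in> set_pmf J \<Longrightarrow> pmf (K w2) (f u) > 0"
    and posL: "\<And>w1 w2 u v. (w1, w2, u, v) \<in> set_pmf J \<Longrightarrow> pmf (L (f u)) (g v) > 0"
  shows "(1 - measure_pmf.prob J {(w1, w2, u, v). d w2 (g v) \<noteq> w1}) * log 2 (real M1) - 1 \<le>
     expect J (\<lambda>(w1, w2, u, v). - log 2 (pmf (K w2) (f u)))
     - expect J (\<lambda>(w1, w2, u, v). - log 2 (pmf (map_pmf f (k1 w1 w2)) (f u)))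
     + (expect J (\<lambda>(w1, w2, u, v). - log 2 (pmf (L (f u)) (g v)))
     - expect J (\<lambda>(w1, w2, u, v). - log 2 (pmf (map_pmf g (k2 u)) (g v))))"
proof -
  have fin: "finite (set_pmf J)"
    unfolding J_def by (intro finite_set_joint_pmf M fin1 fin2)
  define W1 :: "nat \<times> nat \<times> 'u \<times> 'v \<Rightarrow> nat" where "W1 = fst"
  define W2 :: "nat \<times> nat \<times> 'u \<times> 'v \<Rightarrow> nat" where "W2 = (\<lambda>w. fst (snd w))"
  define U :: "nat \<times> nat \<times> 'u \<times> 'v \<Rightarrow> 'u" where "U = (\<lambda>w. fst (snd (snd w)))"
  define V :: "nat \<times> nat \<times> 'u \<times> 'v \<Rightarrow> 'v" where "V = (\<lambda>w. snd (snd (snd w)))"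
  note sel = W1_def W2_def U_def V_def
  let ?UV = "\<lambda>w. (f (U w), g (V w))" and ?W = "\<lambda>w. (W1 w, W2 w)"
  let ?err = "measure_pmf.prob J {(w1, w2, u, v). d w2 (g v) \<noteq> w1}"

  \<comment> \<open>The relay outputs on the receiver's side are handed over as extra observation,
    but the estimator ignores them, so the error probability is that of the actual decoder.\<close>
  have "cond_entropy J W1 (\<lambda>w. (?UV w, W2 w)) \<le> 1 +
      measure_pmf.prob J {w. (\<lambda>((a, b), w2). d w2 b) (?UV w, W2 w) \<noteq> W1 w} * log 2 (real M1)"
    by (rule fano_inequality[OF fin M(1)]) (use M in \<open>auto simp: J_def joint_pmf_def W1_def pmf_of_set_lessThan\<close>)
  also have "{w. (\<lambda>((a, b), w2). d w2 b) (?UV w, W2 w) \<noteq> W1 w} = {(w1, w2, u, v). d w2 (g v) \<noteq> w1}"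
    by (auto simp: sel)
  finally have fano: "cond_entropy J W1 (\<lambda>w. (?UV w, W2 w)) \<le> 1 + ?err * log 2 (real M1)" .

  have "map_pmf ?W J = graph_pmf (map_pmf W2 J) (\<lambda>_. pmf_of_set {..<M1})"
    by (simp add: J_def joint_pmf_def graph_pmf_def map_pmf_def bind_assoc_pmf bind_return_pmf sel)
      (rule bind_commute_pmf)
  from cond_entropy_eq_kernel(1)[OF fin this]
  have "cond_entropy J W1 W2 = expect J (\<lambda>w. - log 2 (pmf (pmf_of_set {..<M1}) (W1 w)))" .
  also have "\<dots> = expect J (\<lambda>w. log 2 (real M1))"
    by (rule expect_cong) (use M in \<open>auto simp: J_def joint_pmf_def W1_def log_divide pmf_of_set_lessThan\<close>)
  finally have uniform: "cond_entropy J W1 W2 = log 2 (real M1)"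
    by simp

  \<comment> \<open>The comparison kernel draws the relay outputs from \<open>W2\<close> alone and
    then the terminal output from those relay outputs alone; it need not be the true conditional
    law.\<close>
  have "cond_entropy J ?UV W2 \<le> expect J (\<lambda>w. - log 2 (pmf (graph_pmf (K (W2 w)) L) (g (V w), f (U w))))"
  proof -
    have "cond_entropy J ?UV W2 = cond_entropy J (\<lambda>w. (g (V w), f (U w))) W2"
      by (rule cond_entropy_cong) auto
    also have "\<dots> \<le> expect J (\<lambda>w. - log 2 (pmf (graph_pmf (K (W2 w)) L) (g (V w), f (U w))))"
      by (rule cond_entropy_le_kernel[OF fin]) (use posK posL in \<open>auto simp: pmf_graph_pmf sel\<close>)
    finally show ?thesis .
  qed
  also have "\<dots> = expect J (\<lambda>w. - log 2 (pmf (K (W2 w)) (f (U w))) + - log 2 (pmf (L (f (U w))) (g (V w))))"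
  proof (rule expect_cong)
    fix w assume "w \<in> set_pmf J"
    then have "pmf (K (W2 w)) (f (U w)) > 0" "pmf (L (f (U w))) (g (V w)) > 0"
      using posK[of "W1 w" "W2 w" "U w" "V w"] posL[of "W1 w" "W2 w" "U w" "V w"] by (auto simp: sel)
    then show "- log 2 (pmf (graph_pmf (K (W2 w)) L) (g (V w), f (U w))) =
        - log 2 (pmf (K (W2 w)) (f (U w))) + - log 2 (pmf (L (f (U w))) (g (V w)))"
      by (simp add: pmf_graph_pmf log_mult)
  qed
  finally have upper: "cond_entropy J ?UV W2 \<le> expect J (\<lambda>w. - log 2 (pmf (K (W2 w)) (f (U w))))
      + expect J (\<lambda>w. - log 2 (pmf (L (f (U w))) (g (V w))))"
    unfolding expect_add[OF fin] .

  have "map_pmf (\<lambda>w. (f (U w), ?W w)) J = graph_pmf (map_pmf ?W J) (\<lambda>(w1, w2). map_pmf f (k1 w1 w2))"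
    by (simp add: J_def joint_pmf_def graph_pmf_def map_pmf_def bind_assoc_pmf bind_return_pmf sel)
  from cond_entropy_eq_kernel(1)[OF fin this]
  have lower1: "cond_entropy J (\<lambda>w. f (U w)) ?W =
      expect J (\<lambda>w. - log 2 (pmf (map_pmf f (k1 (W1 w) (W2 w))) (f (U w))))"
    by simp
  \<comment> \<open>The law of the phase-2 output is known exactly only given all of
    \<open>U\<close>. Replacing \<open>U\<close> by \<open>f U\<close> raises the conditional
    entropy, which is the direction a lower bound allows.\<close>
  have "map_pmf (\<lambda>w. (g (V w), U w, ?W w)) J =
      graph_pmf (map_pmf (\<lambda>w. (U w, ?W w)) J) (\<lambda>(u, _). map_pmf g (k2 u))"
    by (simp add: J_def joint_pmf_def graph_pmf_def map_pmf_def bind_assoc_pmf bind_return_pmf sel)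
  from cond_entropy_eq_kernel(1)[OF fin this]
  have "expect J (\<lambda>w. - log 2 (pmf (map_pmf g (k2 (U w))) (g (V w)))) =
      cond_entropy J (\<lambda>w. g (V w)) (\<lambda>w. (U w, ?W w))"
    by simp
  also have "\<dots> \<le> cond_entropy J (\<lambda>w. g (V w)) (\<lambda>w. (f (U w), ?W w))"
    using cond_entropy_coarsen[OF fin, of "\<lambda>w. g (V w)" "\<lambda>w. (U w, ?W w)" "\<lambda>(u, w). (f u, w)"] by simp
  finally have "expect J (\<lambda>w. - log 2 (pmf (map_pmf f (k1 (W1 w) (W2 w))) (f (U w)))) +
      expect J (\<lambda>w. - log 2 (pmf (map_pmf g (k2 (U w))) (g (V w)))) \<le> cond_entropy J ?UV ?W"
    unfolding cond_entropy_chain lower1 by simp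
  moreover have "cond_entropy J W1 W2 - cond_entropy J W1 (\<lambda>w. (?UV w, W2 w)) =
      cond_entropy J ?UV W2 - cond_entropy J ?UV ?W"
    by (rule cond_entropy_diff_swap)
  ultimately have "(1 - ?err) * log 2 (real M1) - 1 \<le>
     expect J (\<lambda>w. - log 2 (pmf (K (W2 w)) (f (U w))))
     - expect J (\<lambda>w. - log 2 (pmf (map_pmf f (k1 (W1 w) (W2 w))) (f (U w))))
     + (expect J (\<lambda>w. - log 2 (pmf (L (f (U w))) (g (V w))))
     - expect J (\<lambda>w. - log 2 (pmf (map_pmf g (k2 (U w))) (g (V w)))))"
    using fano upper uniform by (simp add: algebra_simps)
  then show ?thesis
    by (simp add: sel case_prod_beta')
qed

section \<open>Product laws along a list of channel uses\<close>

lemma set_seq_pmf: "set_pmf (seq_pmf ps) = {xs. list_all2 (\<lambda>x p. x \<in> set_pmf p) xs ps}"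
  by (induction ps) (auto simp: list_all2_Cons2)

lemma length_seq_pmf: "xs \<in> set_pmf (seq_pmf ps) \<Longrightarrow> length xs = length ps"
  by (auto simp: set_seq_pmf list_all2_lengthD)

lemma nth_seq_pmf: "xs \<in> set_pmf (seq_pmf ps) \<Longrightarrow> k < length ps \<Longrightarrow> xs ! k \<in> set_pmf (ps ! k)"
  by (auto simp: set_seq_pmf list_all2_conv_all_nth)

lemma finite_set_seq_pmf:
  assumes "\<And>p. p \<in> set ps \<Longrightarrow> finite (set_pmf p)"
  shows "finite (set_pmf (seq_pmf ps))"
  using assms by (induction ps) auto

lemma map_seq_pmf: "map_pmf (map h) (seq_pmf ps) = seq_pmf (map (map_pmf h) ps)"
proof (induction ps)
  case (Cons p ps)
  have "map_pmf (map h) (seq_pmf (p # ps)) =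
      bind_pmf p (\<lambda>x. map_pmf ((#) (h x)) (map_pmf (map h) (seq_pmf ps)))"
    by (simp add: map_bind_pmf map_pmf_comp)
  then show ?case
    by (simp add: Cons.IH bind_map_pmf)
qed simp

lemma map_nth_seq_pmf: "k < length ps \<Longrightarrow> map_pmf (\<lambda>xs. xs ! k) (seq_pmf ps) = ps ! k"
proof (induction ps arbitrary: k)
  case (Cons p ps)
  then show ?case
    by (cases k) (auto simp: map_bind_pmf map_pmf_comp map_pmf_const bind_return_pmf')
qed simp

lemma pmf_seq_pmf:
  "length xs = length ps \<Longrightarrow> pmf (seq_pmf ps) xs = (\<Prod>k<length ps. pmf (ps ! k) (xs ! k))"
proof (induction ps arbitrary: xs)
  case (Cons p ps)
  then obtain y ys where xs: "xs = y # ys" "length ys = length ps"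
    by (cases xs) auto
  have *: "pmf (map_pmf ((#) x) (seq_pmf ps)) (y # ys) = indicator {y} x * pmf (seq_pmf ps) ys" for x
    by (auto simp: pmf_map vimage_def indicator_def pmf.rep_eq intro: arg_cong)
  have "pmf (seq_pmf (p # ps)) xs = pmf p y * pmf (seq_pmf ps) ys"
    unfolding xs seq_pmf.simps pmf_bind *
    by (subst integral_measure_pmf_real[of "{y}"]) (auto simp: indicator_def)
  then show ?case
    using Cons.IH[OF xs(2)] by (simp add: xs(1) prod.lessThan_Suc_shift del: seq_pmf.simps prod.lessThan_Suc)
qed simp

lemma log_pmf_seq_pmf:
  assumes "length xs = length ps" "\<And>k. k < length ps \<Longrightarrow> pmf (ps ! k) (xs ! k) > 0"
  shows "- log 2 (pmf (seq_pmf ps) xs) = (\<Sum>k<length ps. - log 2 (pmf (ps ! k) (xs ! k)))"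
    and "pmf (seq_pmf ps) xs > 0"
proof -
  show "- log 2 (pmf (seq_pmf ps) xs) = (\<Sum>k<length ps. - log 2 (pmf (ps ! k) (xs ! k)))"
    using assms
    by (simp add: pmf_seq_pmf log_def ln_prod sum_negf flip: sum_divide_distrib)
      (subst ln_prod, auto simp: less_imp_neq[THEN not_sym])
  show "pmf (seq_pmf ps) xs > 0"
    using assms by (auto simp: pmf_seq_pmf intro!: prod_pos)
qed

section \<open>Single-letter bound for one cut\<close>

definition mac_pmf :: "'a pmf \<Rightarrow> 'b pmf \<Rightarrow> ('a \<Rightarrow> 'b \<Rightarrow> 'y pmf) \<Rightarrow> ('a \<times> 'b \<times> 'y) pmf" where
  "mac_pmf pa pb p1 =
     bind_pmf pa (\<lambda>a. bind_pmf pb (\<lambda>b. map_pmf (\<lambda>y. (a, b, y)) (p1 a b)))"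

definition chan_pmf :: "'x pmf \<Rightarrow> ('x \<Rightarrow> 'o pmf) \<Rightarrow> ('x \<times> 'o) pmf" where
  "chan_pmf px p2 = bind_pmf px (\<lambda>x. map_pmf (Pair x) (p2 x))"

lemma expect_pmf_of_set_lessThan:
  assumes "n > 0"
  shows "real n * expect (pmf_of_set {..<n}) f = (\<Sum>k<n. f k)"
  using assms
  by (subst expect_finite)
    (auto simp: pmf_of_set_lessThan sum_divide_distrib[symmetric])

text \<open>
  The maps \<^term>\<open>h\<close> and \<^term>\<open>r\<close> restrict phase-1 outputs and relay inputs to the relays on the
  receiver's side of the cut, \<^term>\<open>s\<close> restricts relay inputs to the other side. The assumption \<open>causal\<close>
  is where relays use only their own outputs.
\<close>

lemma code_bound:
  fixes p1 :: "'a \<Rightarrow> 'b \<Rightarrow> 'y pmf" and p2 :: "'x \<Rightarrow> 'o pmf"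
    and e1 :: "nat \<Rightarrow> nat \<Rightarrow> 'a" and e2 :: "nat \<Rightarrow> nat \<Rightarrow> 'b" and x :: "nat \<Rightarrow> 'y list \<Rightarrow> 'x"
    and n1 n2 :: nat and px :: "'x pmf"
    and h :: "'y \<Rightarrow> 'c" and g :: "'o \<Rightarrow> 'd" and r :: "'x \<Rightarrow> 'e" and s :: "'x \<Rightarrow> 'f"
  assumes M: "M1 > 0" "M2 > 0" and fin1: "\<And>w1 w2 k. finite (set_pmf (p1 (e1 w1 k) (e2 w2 k)))"
    and fin2: "\<And>k u. finite (set_pmf (p2 (x k u)))"
    and causal: "\<And>k u. r (x k u) = rk k (map h u)"
    and joint_inj: "\<And>k u k' u'. r (x k u) = r (x k' u') \<Longrightarrow> s (x k u) = s (x k' u') \<Longrightarrow> x k u = x k' u'"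
  defines "J \<equiv> joint_pmf M1 M2 (\<lambda>w1 w2. seq_pmf (map (\<lambda>k. p1 (e1 w1 k) (e2 w2 k)) [0..<n1]))
              (\<lambda>u. seq_pmf (map (\<lambda>k. p2 (x k u)) [0..<n2]))"
  defines "D1 \<equiv> \<lambda>k. mac_pmf (map_pmf (\<lambda>w. e1 w k) (pmf_of_set {..<M1}))
              (map_pmf (\<lambda>w. e2 w k) (pmf_of_set {..<M2})) p1"
  assumes px: "n2 > 0 \<Longrightarrow>
      px = bind_pmf (pmf_of_set {..<n2}) (\<lambda>k. map_pmf (\<lambda>(w1, w2, u, v). x k u) J)"
  shows "(1 - measure_pmf.prob J {(w1, w2, u, v). d w2 (map g v) \<noteq> w1}) * log 2 (real M1) - 1 \<le>
     (\<Sum>k<n1. cmi (D1 k) (\<lambda>(a, b, y). a) (\<lambda>(a, b, y). h y) (\<lambda>(a, b, y). b)) +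
     real n2 * cmi (chan_pmf px p2) (\<lambda>(x, y). s x) (\<lambda>(x, y). g y) (\<lambda>(x, y). r x)"
proof -
  have fin: "finite (set_pmf J)"
    unfolding J_def by (intro finite_set_joint_pmf M finite_set_seq_pmf) (use fin1 fin2 in auto)
  \<comment> \<open>At a fixed time each input is a function of its own message and of nothing else,
    since nothing is fed back in phase 1. Independent messages therefore give independent inputs,
    the form \<open>mac_pmf\<close>.\<close>
  have marg1: "map_pmf (\<lambda>(w1, w2, u, v). (e1 w1 k, e2 w2 k, u ! k)) J = D1 k" if "k < n1" for k
  proof -
    have "map_pmf (\<lambda>(w1, w2, u, v). (e1 w1 k, e2 w2 k, u ! k)) J =
        bind_pmf (pmf_of_set {..<M1}) (\<lambda>w1. bind_pmf (pmf_of_set {..<M2}) (\<lambda>w2.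
          map_pmf (\<lambda>y. (e1 w1 k, e2 w2 k, y)) (map_pmf (\<lambda>u. u ! k)
            (seq_pmf (map (\<lambda>k. p1 (e1 w1 k) (e2 w2 k)) [0..<n1])))))"
      by (simp add: J_def joint_pmf_def map_bind_pmf map_pmf_comp map_pmf_const)
        (simp add: map_pmf_def)
    also have "\<dots> = D1 k"
      using that by (simp add: map_nth_seq_pmf D1_def mac_pmf_def bind_map_pmf)
    finally show ?thesis .
  qed
  have marg2: "map_pmf (\<lambda>(w1, w2, u, v). (x k u, v ! k)) J =
      chan_pmf (map_pmf (\<lambda>(w1, w2, u, v). x k u) J) p2" if "k < n2" for k
  proof -
    have "map_pmf (\<lambda>(w1, w2, u, v). (x k u, v ! k)) J =
        bind_pmf (pmf_of_set {..<M1}) (\<lambda>w1. bind_pmf (pmf_of_set {..<M2}) (\<lambda>w2.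
          bind_pmf (seq_pmf (map (\<lambda>k. p1 (e1 w1 k) (e2 w2 k)) [0..<n1])) (\<lambda>u.
          map_pmf (Pair (x k u)) (map_pmf (\<lambda>v. v ! k) (seq_pmf (map (\<lambda>k. p2 (x k u)) [0..<n2]))))))"
      by (simp add: J_def joint_pmf_def map_bind_pmf map_pmf_comp)
    also have "\<dots> = chan_pmf (map_pmf (\<lambda>(w1, w2, u, v). x k u) J) p2"
      using that by (simp add: map_nth_seq_pmf chan_pmf_def J_def joint_pmf_def map_bind_pmf
          map_pmf_comp bind_map_pmf bind_assoc_pmf bind_return_pmf)
    finally show ?thesis .
  qed
  have finD1: "finite (set_pmf (D1 k))" for k
    using fin1 M by (auto simp: D1_def mac_pmf_def pmf_of_set_lessThan)
  have memJ: "(w1, w2, u, v) \<in> set_pmf J \<Longrightarrow>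
      length u = n1 \<and> length v = n2 \<and> (\<forall>k<n1. u ! k \<in> set_pmf (p1 (e1 w1 k) (e2 w2 k))) \<and>
      (\<forall>k<n2. v ! k \<in> set_pmf (p2 (x k u)))" for w1 w2 u v
    by (auto simp: J_def joint_pmf_def dest: length_seq_pmf nth_seq_pmf)

  define D2 where "D2 = chan_pmf px p2"
  have setpx: "x' \<in> set_pmf px \<Longrightarrow> \<exists>k u. x' = x k u" if "n2 > 0" for x'
    using that by (auto simp: px pmf_of_set_lessThan)
  have finD2: "finite (set_pmf D2)" if "n2 > 0"
  proof -
    have "finite (set_pmf px)"
      using fin that by (auto simp: px pmf_of_set_lessThan)
    then show ?thesis
      using fin2 setpx[OF that] by (fastforce simp: D2_def chan_pmf_def)
  qed
  \<comment> \<open>Summed over time, the expectation of any function of a single use is linear in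
    the use's law, so it is \<open>n2\<close> times an expectation under the averaged law. Both
    phase-2 terms are of this kind. For \<open>n2 = 0\<close> both sides vanish, whatever
    \<open>px\<close> is.\<close>
  have mix: "(\<Sum>k<n2. expect J (\<lambda>(w1, w2, u, v). \<phi> (x k u, v ! k))) = real n2 * expect D2 \<phi>" for \<phi>
  proof (cases "n2 > 0")
    case True
    have "D2 = bind_pmf (pmf_of_set {..<n2}) (\<lambda>k. chan_pmf (map_pmf (\<lambda>(w1, w2, u, v). x k u) J) p2)"
      using True by (simp add: D2_def px chan_pmf_def bind_assoc_pmf)
    also have "\<dots> = bind_pmf (pmf_of_set {..<n2}) (\<lambda>k. map_pmf (\<lambda>(w1, w2, u, v). (x k u, v ! k)) J)"
      using True by (intro bind_pmf_cong refl) (simp add: marg2 pmf_of_set_lessThan)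
    finally have "expect D2 \<phi> =
        expect (pmf_of_set {..<n2}) (\<lambda>k. expect J (\<lambda>(w1, w2, u, v). \<phi> (x k u, v ! k)))"
      using True fin by (simp add: expect_bind pmf_of_set_lessThan case_prod_beta')
    then show ?thesis
      using True by (simp add: expect_pmf_of_set_lessThan)
  qed simp

  \<comment> \<open>One kernel for each use, since the phase-1 laws are not merged; below,
    \<open>L0\<close> is a single kernel shared by all phase-2 uses.\<close>
  define K1 where "K1 k = cond_kernel (D1 k) (\<lambda>(a, b, y). h y) (\<lambda>(a, b, y). b)" for k
  note K1_eq = cond_entropy_eq_kernel[OF finD1 disintegration[of "\<lambda>(a, b, y). h y" "\<lambda>(a, b, y). b" "D1 k" for k], folded K1_def]
  define L0 where "L0 = cond_kernel D2 (\<lambda>(x, y). g y) (\<lambda>(x, y). r x)"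
  note L0_eq = cond_entropy_eq_kernel[OF finD2 disintegration[of "\<lambda>(x, y). g y" "\<lambda>(x, y). r x"], folded L0_def]

  have posK1: "pmf (K1 k (e2 w2 k)) (h (u ! k)) > 0" if "(w1, w2, u, v) \<in> set_pmf J" "k < n1"
    for w1 w2 u v k
  proof -
    have "(e1 w1 k, e2 w2 k, u ! k) \<in> set_pmf (D1 k)"
      using that(1) unfolding marg1[OF that(2), symmetric] by force
    from K1_eq(2)[OF this] show ?thesis by simp
  qed
  have posL0: "pmf (L0 (r (x k u))) (g (v ! k)) > 0" if J: "(w1, w2, u, v) \<in> set_pmf J" and k: "k < n2"
    for w1 w2 u v k
  proof -
    have "x k u \<in> set_pmf px"
      using k J by (force simp: px pmf_of_set_lessThan)
    then have "(x k u, v ! k) \<in> set_pmf D2"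
      using memJ[OF J] k by (auto simp: D2_def chan_pmf_def)
    from L0_eq(2)[OF _ this] k show ?thesis by auto
  qed

  define K where "K w2 = seq_pmf (map (\<lambda>k. K1 k (e2 w2 k)) [0..<n1])" for w2
  \<comment> \<open>By causality \<open>rk\<close> rebuilds the relay inputs on the receiver's side
    from the outputs \<open>c\<close> of those relays, so this kernel sees nothing across the
    cut.\<close>
  define L where "L c = seq_pmf (map (\<lambda>k. L0 (rk k c)) [0..<n2])" for c
  have logK: "- log 2 (pmf (K w2) (map h u)) = (\<Sum>k<n1. - log 2 (pmf (K1 k (e2 w2 k)) (h (u ! k))))"
    "pmf (K w2) (map h u) > 0" if "(w1, w2, u, v) \<in> set_pmf J" for w1 w2 u v
    using log_pmf_seq_pmf[of "map h u" "map (\<lambda>k. K1 k (e2 w2 k)) [0..<n1]"] memJ[OF that] posK1[OF that]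
    by (auto simp: K_def)
  have logL: "- log 2 (pmf (L (map h u)) (map g v)) = (\<Sum>k<n2. - log 2 (pmf (L0 (r (x k u))) (g (v ! k))))"
    "pmf (L (map h u)) (map g v) > 0" if "(w1, w2, u, v) \<in> set_pmf J" for w1 w2 u v
    using log_pmf_seq_pmf[of "map g v" "map (\<lambda>k. L0 (rk k (map h u))) [0..<n2]"] memJ[OF that]
      posL0[OF that]
    by (auto simp: L_def causal)
  have logp1: "- log 2 (pmf (map_pmf (map h) (seq_pmf (map (\<lambda>k. p1 (e1 w1 k) (e2 w2 k)) [0..<n1]))) (map h u)) =
      (\<Sum>k<n1. - log 2 (pmf (map_pmf h (p1 (e1 w1 k) (e2 w2 k))) (h (u ! k))))"
    if "(w1, w2, u, v) \<in> set_pmf J" for w1 w2 u v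
    using memJ[OF that] unfolding map_seq_pmf
    by (subst log_pmf_seq_pmf) (auto simp: pmf_positive_iff)
  have logp2: "- log 2 (pmf (map_pmf (map g) (seq_pmf (map (\<lambda>k. p2 (x k u)) [0..<n2]))) (map g v)) =
      (\<Sum>k<n2. - log 2 (pmf (map_pmf g (p2 (x k u))) (g (v ! k))))"
    if "(w1, w2, u, v) \<in> set_pmf J" for w1 w2 u v
    using memJ[OF that] unfolding map_seq_pmf
    by (subst log_pmf_seq_pmf) (auto simp: pmf_positive_iff)

  have marg1_expect: "expect J (\<lambda>(w1, w2, u, v). \<phi> (e1 w1 k, e2 w2 k, u ! k)) = expect (D1 k) \<phi>"
    if "k < n1" for k \<phi>
    unfolding marg1[OF that, symmetric] by (simp add: case_prod_beta')
  have EK: "expect J (\<lambda>(w1, w2, u, v). - log 2 (pmf (K w2) (map h u))) =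
      (\<Sum>k<n1. cond_entropy (D1 k) (\<lambda>(a, b, y). h y) (\<lambda>(a, b, y). b))"
  proof -
    have "expect J (\<lambda>(w1, w2, u, v). - log 2 (pmf (K w2) (map h u))) =
        expect J (\<lambda>w. \<Sum>k<n1. (\<lambda>(w1, w2, u, v). - log 2 (pmf (K1 k (e2 w2 k)) (h (u ! k)))) w)"
      by (rule expect_cong) (use logK in auto)
    also have "\<dots> = (\<Sum>k<n1. expect (D1 k) (\<lambda>(a, b, y). - log 2 (pmf (K1 k b) (h y))))"
      unfolding expect_sum[OF fin]
      by (intro sum.cong refl) (simp flip: marg1_expect add: case_prod_beta')
    also have "\<dots> = (\<Sum>k<n1. cond_entropy (D1 k) (\<lambda>(a, b, y). h y) (\<lambda>(a, b, y). b))"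
      unfolding K1_eq(1) by (simp add: case_prod_beta')
    finally show ?thesis .
  qed
  have Ep1: "expect J (\<lambda>(w1, w2, u, v).
      - log 2 (pmf (map_pmf (map h) (seq_pmf (map (\<lambda>k. p1 (e1 w1 k) (e2 w2 k)) [0..<n1]))) (map h u))) =
      (\<Sum>k<n1. cond_entropy (D1 k) (\<lambda>(a, b, y). h y) (\<lambda>w. ((\<lambda>(a, b, y). a) w, (\<lambda>(a, b, y). b) w)))"
    (is "?l = _")
  proof -
    have "?l = expect J (\<lambda>w. \<Sum>k<n1. (\<lambda>(w1, w2, u, v).
        - log 2 (pmf (map_pmf h (p1 (e1 w1 k) (e2 w2 k))) (h (u ! k)))) w)"
      by (rule expect_cong) (use logp1 in auto)
    also have "\<dots> = (\<Sum>k<n1. expect (D1 k) (\<lambda>(a, b, y). - log 2 (pmf (map_pmf h (p1 a b)) (h y))))"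
      unfolding expect_sum[OF fin]
      by (intro sum.cong refl) (simp flip: marg1_expect add: case_prod_beta')
    also have "\<dots> = (\<Sum>k<n1. cond_entropy (D1 k) (\<lambda>(a, b, y). h y)
        (\<lambda>w. ((\<lambda>(a, b, y). a) w, (\<lambda>(a, b, y). b) w)))"
    proof (intro sum.cong refl)
      fix k
      have "map_pmf (\<lambda>w. ((\<lambda>(a, b, y). h y) w, ((\<lambda>(a, b, y). a) w, (\<lambda>(a, b, y). b) w))) (D1 k) =
        graph_pmf (map_pmf (\<lambda>w. ((\<lambda>(a, b, y). a) w, (\<lambda>(a, b, y). b) w)) (D1 k))
          (\<lambda>(a, b). map_pmf h (p1 a b))"
        by (simp add: D1_def mac_pmf_def graph_pmf_def map_pmf_def bind_assoc_pmf bind_return_pmf)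
      from cond_entropy_eq_kernel(1)[OF finD1 this]
      show "expect (D1 k) (\<lambda>(a, b, y). - log 2 (pmf (map_pmf h (p1 a b)) (h y))) =
          cond_entropy (D1 k) (\<lambda>(a, b, y). h y) (\<lambda>w. ((\<lambda>(a, b, y). a) w, (\<lambda>(a, b, y). b) w))"
        by (simp add: case_prod_beta')
    qed
    finally show ?thesis .
  qed
  have EL: "expect J (\<lambda>(w1, w2, u, v). - log 2 (pmf (L (map h u)) (map g v))) =
      real n2 * cond_entropy D2 (\<lambda>(x, y). g y) (\<lambda>(x, y). r x)"
  proof -
    have "expect J (\<lambda>(w1, w2, u, v). - log 2 (pmf (L (map h u)) (map g v))) =
        expect J (\<lambda>w. \<Sum>k<n2. (\<lambda>(w1, w2, u, v). - log 2 (pmf (L0 (r (x k u))) (g (v ! k)))) w)"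
      by (rule expect_cong) (use logL in auto)
    also have "\<dots> = real n2 * expect D2 (\<lambda>(x, y). - log 2 (pmf (L0 (r x)) (g y)))"
      unfolding expect_sum[OF fin] by (simp flip: mix add: case_prod_beta' sum_negf)
    also have "\<dots> = real n2 * cond_entropy D2 (\<lambda>(x, y). g y) (\<lambda>(x, y). r x)"
      by (cases "n2 > 0") (subst L0_eq(1), simp_all add: case_prod_beta')
    finally show ?thesis .
  qed
  have Ep2: "expect J (\<lambda>(w1, w2, u, v).
      - log 2 (pmf (map_pmf (map g) (seq_pmf (map (\<lambda>k. p2 (x k u)) [0..<n2]))) (map g v))) =
      real n2 * cond_entropy D2 (\<lambda>(x, y). g y) (\<lambda>w. ((\<lambda>(x, y). s x) w, (\<lambda>(x, y). r x) w))"
    (is "?l = _")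
  proof -
    have "?l = expect J (\<lambda>w. \<Sum>k<n2. (\<lambda>(w1, w2, u, v).
        - log 2 (pmf (map_pmf g (p2 (x k u))) (g (v ! k)))) w)"
      by (rule expect_cong) (use logp2 in auto)
    also have "\<dots> = real n2 * expect D2 (\<lambda>(x, y). - log 2 (pmf (map_pmf g (p2 x)) (g y)))"
      unfolding expect_sum[OF fin] by (simp flip: mix add: case_prod_beta' sum_negf)
    also have "\<dots> = real n2 * cond_entropy D2 (\<lambda>(x, y). g y)
        (\<lambda>w. ((\<lambda>(x, y). s x) w, (\<lambda>(x, y). r x) w))"
    proof (cases "n2 > 0")
      case True
      have "map_pmf (\<lambda>w. ((\<lambda>(x, y). g y) w, fst w)) D2 =
        graph_pmf (map_pmf fst D2) (\<lambda>x. map_pmf g (p2 x))"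
        by (simp add: D2_def chan_pmf_def graph_pmf_def map_pmf_def bind_assoc_pmf bind_return_pmf)
      from cond_entropy_eq_kernel(1)[OF finD2[OF True] this]
      have "expect D2 (\<lambda>(x, y). - log 2 (pmf (map_pmf g (p2 x)) (g y))) =
          cond_entropy D2 (\<lambda>(x, y). g y) fst"
        by (simp add: case_prod_beta')
      \<comment> \<open>The channel kernel conditions on the whole relay input; by
        \<open>joint_inj\<close> its two restrictions determine it on the support of
        \<open>D2\<close>.\<close>
      also have "\<dots> = cond_entropy D2 (\<lambda>(x, y). g y) (\<lambda>w. ((\<lambda>(x, y). s x) w, (\<lambda>(x, y). r x) w))"
      proof (rule cond_entropy_cong)
        fix v w assume "v \<in> set_pmf D2" "w \<in> set_pmf D2"
        then obtain k u k' u' where "fst v = x k u" "fst w = x k' u'"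
          using setpx[OF True] by (fastforce simp: D2_def chan_pmf_def)
        then show "fst v = fst w \<longleftrightarrow> ((\<lambda>(x, y). s x) v, (\<lambda>(x, y). r x) v) =
            ((\<lambda>(x, y). s x) w, (\<lambda>(x, y). r x) w)"
          using joint_inj by (auto simp: case_prod_beta')
      qed simp
      finally show ?thesis by simp
    qed simp
    finally show ?thesis .
  qed

  have "(1 - measure_pmf.prob J {(w1, w2, u, v). d w2 (map g v) \<noteq> w1}) * log 2 (real M1) - 1 \<le>
     expect J (\<lambda>(w1, w2, u, v). - log 2 (pmf (K w2) (map h u)))
     - expect J (\<lambda>(w1, w2, u, v).
      - log 2 (pmf (map_pmf (map h) (seq_pmf (map (\<lambda>k. p1 (e1 w1 k) (e2 w2 k)) [0..<n1]))) (map h u)))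
     + (expect J (\<lambda>(w1, w2, u, v). - log 2 (pmf (L (map h u)) (map g v)))
     - expect J (\<lambda>(w1, w2, u, v).
      - log 2 (pmf (map_pmf (map g) (seq_pmf (map (\<lambda>k. p2 (x k u)) [0..<n2]))) (map g v))))"
    unfolding J_def
    by (rule joint_pmf_bound[OF M])
      (use logK(2) logL(2) fin1 fin2 in \<open>auto simp: J_def[symmetric] intro!: finite_set_seq_pmf\<close>)
  also have "\<dots> = (\<Sum>k<n1. cmi (D1 k) (\<lambda>(a, b, y). a) (\<lambda>(a, b, y). h y) (\<lambda>(a, b, y). b)) +
     real n2 * cmi D2 (\<lambda>(x, y). s x) (\<lambda>(x, y). g y) (\<lambda>(x, y). r x)"
    unfolding EK Ep1 EL Ep2
    by (cases "n2 > 0") (simp_all add: cmi_eq_cond_entropy finD1 finD2 sum_subtractf right_diff_distrib)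
  finally show ?thesis unfolding D2_def .
qed

section \<open>Caratheodory reduction and compactness\<close>

text \<open>Gaussian elimination, one equation at a time: equation \<open>i\<close> is solved for
  the unknown at a pivot \<open>s\<close>, which is substituted into the others; \<open>f'\<close>
  holds the reduced coefficients. The solution is extended to \<open>s\<close> by the value
  \<open>a\<close> that equation \<open>i\<close> forces.\<close>

lemma homogeneous_system_nontrivial:
  fixes f :: "'j \<Rightarrow> 't \<Rightarrow> real"
  assumes "finite J" "finite T" "card J < card T"
  shows "\<exists>c. (\<exists>t\<in>T. c t \<noteq> 0) \<and> (\<forall>j\<in>J. (\<Sum>t\<in>T. c t * f j t) = 0)"
  using assms
proof (induction J arbitrary: f T rule: finite_induct)
  case empty
  then have "T \<noteq> {}" by auto
  then show ?case by (intro exI[of _ "\<lambda>_. 1"]) auto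
next
  case (insert i J)
  show ?case
  proof (cases "\<forall>t\<in>T. f i t = 0")
    case True
    obtain c where "\<exists>t\<in>T. c t \<noteq> 0" "\<forall>j\<in>J. (\<Sum>t\<in>T. c t * f j t) = 0"
      using insert.IH[of T f] insert.hyps insert.prems by auto
    with True show ?thesis by auto
  next
    case False
    then obtain s where s: "s \<in> T" "f i s \<noteq> 0" by blast
    let ?T = "T - {s}"
    define f' where "f' j t = f j t - f i t / f i s * f j s" for j t
    have "card J < card ?T"
      using insert.hyps insert.prems s by (simp add: card_Diff_singleton)
    then obtain c where c: "\<exists>t\<in>?T. c t \<noteq> 0" "\<forall>j\<in>J. (\<Sum>t\<in>?T. c t * f' j t) = 0"
      using insert.IH[of ?T f'] insert.prems by auto
    define a where "a = - (\<Sum>t\<in>?T. c t * f i t) / f i s"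
    let ?c = "c(s := a)"
    have sum: "(\<Sum>t\<in>T. ?c t * f j t) = a * f j s + (\<Sum>t\<in>?T. c t * f j t)" for j
    proof -
      have "(\<Sum>t\<in>T. ?c t * f j t) = ?c s * f j s + (\<Sum>t\<in>?T. ?c t * f j t)"
        using insert.prems s by (intro sum.remove) auto
      also have "(\<Sum>t\<in>?T. ?c t * f j t) = (\<Sum>t\<in>?T. c t * f j t)"
        by (intro sum.cong) auto
      finally show ?thesis by simp
    qed
    have "(\<Sum>t\<in>T. ?c t * f i t) = 0"
      unfolding sum using s by (simp add: a_def)
    moreover have "(\<Sum>t\<in>T. ?c t * f j t) = 0" if "j \<in> J" for j
    proof -
      have "(\<Sum>t\<in>?T. c t * f' j t) = (\<Sum>t\<in>?T. c t * f j t) + a * f j s"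
        by (simp add: f'_def a_def algebra_simps sum_subtractf sum_distrib_left sum_divide_distrib)
      then show ?thesis
        using c(2) that unfolding sum by simp
    qed
    moreover have "\<exists>t\<in>T. ?c t \<noteq> 0"
      using c(1) by auto
    ultimately show ?thesis by (intro exI[of _ ?c]) auto
  qed
qed

text \<open>A nonzero vector \<open>c\<close> with total 0 and orthogonal to every
  \<open>f j\<close> is a direction along which mass and expectations do not change. Moving from
  \<open>p\<close> against \<open>c\<close> until a weight reaches 0 removes a support
  point.\<close>

lemma caratheodory_pmf_step:
  fixes f :: "'j \<Rightarrow> 't \<Rightarrow> real"
  assumes J: "finite J" and p: "finite (set_pmf p)" and card: "card (set_pmf p) > card J + 1"
  shows "\<exists>p'. set_pmf p' \<subset> set_pmf p \<and> (\<forall>j\<in>J. expect p' (f j) = expect p (f j))"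
proof -
  let ?T = "set_pmf p"
  \<comment> \<open>\<open>None\<close> indexes the equation that preserves total mass; it is the
    source of the \<open>+ 1\<close>.\<close>
  have "card (insert None (Some ` J)) < card ?T"
    using J card by (simp add: card_image)
  from homogeneous_system_nontrivial[OF _ p this, of "\<lambda>j. case j of None \<Rightarrow> \<lambda>_. 1 | Some j \<Rightarrow> f j"] J
  obtain c where c: "\<exists>t\<in>?T. c t \<noteq> 0" and c0: "(\<Sum>t\<in>?T. c t) = 0"
    and cJ: "\<And>j. j \<in> J \<Longrightarrow> (\<Sum>t\<in>?T. c t * f j t) = 0"
    by auto
  have "\<exists>t\<in>?T. c t > 0"
  proof (rule ccontr)
    assume *: "\<not> ?thesis"
    then have "\<forall>t\<in>?T. - c t = 0"
      using c0 p by (subst sum_nonneg_eq_0_iff[symmetric]) (auto simp: sum_negf not_less)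
    with c show False by auto
  qed
  then have ne: "{t \<in> ?T. c t > 0} \<noteq> {}" by auto
  \<comment> \<open>The largest multiple of \<open>c\<close> that can be subtracted without making a
    weight negative; a point \<open>s\<close> attaining the minimum loses all its mass.\<close>
  define step where "step = Min ((\<lambda>t. pmf p t / c t) ` {t \<in> ?T. c t > 0})"
  have "step \<in> (\<lambda>t. pmf p t / c t) ` {t \<in> ?T. c t > 0}"
    unfolding step_def using p ne by (intro Min_in) auto
  then obtain s where s: "s \<in> ?T" "c s > 0" "step = pmf p s / c s" by auto
  have le: "step \<le> pmf p t / c t" if "t \<in> ?T" "c t > 0" for t
    unfolding step_def using p that by (intro Min_le) auto
  have "step \<ge> 0" using s by simp
  define w where "w t = (if t \<in> ?T then pmf p t - step * c t else 0)" for t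
  have w_nonneg: "w t \<ge> 0" for t
  proof (cases "t \<in> ?T \<and> c t > 0")
    case True
    then show ?thesis using le[of t] by (simp add: w_def field_simps)
  next
    case False
    then have "t \<in> ?T \<Longrightarrow> step * c t \<le> 0"
      using \<open>step \<ge> 0\<close> by (simp add: mult_nonneg_nonpos)
    then show ?thesis by (auto simp: w_def intro: order_trans[OF _ pmf_nonneg])
  qed
  have "(\<integral>\<^sup>+ t. ennreal (w t) \<partial>count_space UNIV) = (\<Sum>t\<in>?T. ennreal (w t))"
    by (rule nn_integral_count_space'[OF p]) (auto simp: w_def)
  also have "\<dots> = ennreal (\<Sum>t\<in>?T. w t)"
    using w_nonneg by (intro sum_ennreal) auto
  also have "(\<Sum>t\<in>?T. w t) = (\<Sum>t\<in>?T. pmf p t) - step * (\<Sum>t\<in>?T. c t)"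
    by (simp add: w_def sum_subtractf sum_distrib_left)
  also have "\<dots> = 1"
    using p c0 by (simp add: sum_pmf_eq_1)
  finally have w1: "(\<integral>\<^sup>+ t. ennreal (w t) \<partial>count_space UNIV) = 1" by simp
  define p' where "p' = embed_pmf w"
  have pmf_p': "pmf p' t = w t" for t
    unfolding p'_def by (rule pmf_embed_pmf[OF w_nonneg w1])
  have sub: "set_pmf p' \<subseteq> ?T"
    by (auto simp: set_pmf_iff[of _ p'] pmf_p' w_def split: if_splits)
  moreover have "s \<notin> set_pmf p'"
    using s by (simp add: set_pmf_iff[of _ p'] pmf_p' w_def)
  moreover have "expect p' (f j) = expect p (f j)" if "j \<in> J" for j
  proof -
    have "expect p' (f j) = (\<Sum>t\<in>?T. pmf p t * f j t) - step * (\<Sum>t\<in>?T. c t * f j t)"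
      unfolding expect_superset[OF p sub]
      by (simp add: pmf_p' w_def left_diff_distrib sum_subtractf sum_distrib_left mult.assoc)
    also have "\<dots> = expect p (f j)"
      using cJ[OF that] by (simp add: expect_finite[OF p])
    finally show ?thesis .
  qed
  ultimately show ?thesis using s(1) by (intro exI[of _ p']) auto
qed

lemma caratheodory_pmf:
  fixes f :: "'j \<Rightarrow> 't \<Rightarrow> real"
  assumes "finite J" "finite (set_pmf p)"
  shows "\<exists>p'. set_pmf p' \<subseteq> set_pmf p \<and> card (set_pmf p') \<le> card J + 1 \<and>
           (\<forall>j\<in>J. expect p' (f j) = expect p (f j))"
  using assms(2)
proof (induction "card (set_pmf p)" arbitrary: p rule: less_induct)
  case less
  show ?case
  proof (cases "card (set_pmf p) \<le> card J + 1")
    case False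
    then obtain p' where p': "set_pmf p' \<subset> set_pmf p" "\<forall>j\<in>J. expect p' (f j) = expect p (f j)"
      using caratheodory_pmf_step[OF assms(1) less.prems, of f] by auto
    moreover have "card (set_pmf p') < card (set_pmf p)"
      using p'(1) less.prems by (intro psubset_card_mono)
    moreover have "finite (set_pmf p')"
      using p'(1) less.prems by (auto intro: finite_subset)
    ultimately obtain p'' where "set_pmf p'' \<subseteq> set_pmf p'" "card (set_pmf p'') \<le> card J + 1"
      "\<forall>j\<in>J. expect p'' (f j) = expect p' (f j)"
      using less.hyps by metis
    with p' show ?thesis by (intro exI[of _ p'']) auto
  qed auto
qed

section \<open>Compactness and continuity on a fixed finite carrier\<close>

text \<open>With all supports in one finite set, pointwise convergence of the masses is ordinary
  convergence in the probability simplex.\<close>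

definition pmf_tendsto :: "(nat \<Rightarrow> 'a pmf) \<Rightarrow> 'a pmf \<Rightarrow> bool" where
  "pmf_tendsto P Q \<longleftrightarrow> (\<forall>x. (\<lambda>n. pmf (P n) x) \<longlonglongrightarrow> pmf Q x)"

lemma pmf_tendsto_const: "pmf_tendsto (\<lambda>_. p) p"
  by (simp add: pmf_tendsto_def)

lemma pmf_tendsto_subseq:
  "pmf_tendsto P Q \<Longrightarrow> strict_mono r \<Longrightarrow> pmf_tendsto (\<lambda>n. P (r n)) Q"
  unfolding pmf_tendsto_def using LIMSEQ_subseq_LIMSEQ[of _ _ r] by (auto simp: o_def)

lemma pmf_tendsto_support:
  assumes "\<And>n. set_pmf (P n) \<subseteq> A" "pmf_tendsto P Q"
  shows "set_pmf Q \<subseteq> A"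
proof
  fix x assume "x \<in> set_pmf Q"
  show "x \<in> A"
  proof (rule ccontr)
    assume "x \<notin> A"
    then have "pmf (P n) x = 0" for n
      using assms(1)[of n] by (auto simp: set_pmf_iff)
    moreover have "(\<lambda>n. pmf (P n) x) \<longlonglongrightarrow> pmf Q x"
      using assms(2) by (simp add: pmf_tendsto_def)
    ultimately have "pmf Q x = 0"
      by (simp add: LIMSEQ_const_iff)
    with \<open>x \<in> set_pmf Q\<close> show False by (simp add: set_pmf_iff)
  qed
qed

text \<open>Bolzano-Weierstrass once per index, each time inside the subsequence already
  found.\<close>

lemma bounded_family_subseq:
  fixes f :: "'i \<Rightarrow> nat \<Rightarrow> real"
  assumes "finite I" "\<And>i. i \<in> I \<Longrightarrow> bounded (range (f i))"
  shows "\<exists>r. strict_mono (r :: nat \<Rightarrow> nat) \<and> (\<forall>i\<in>I. convergent (\<lambda>n. f i (r n)))"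
  using assms
proof (induction I rule: finite_induct)
  case empty
  show ?case by (intro exI[of _ id]) (auto simp: strict_mono_def)
next
  case (insert j I)
  then obtain r where r: "strict_mono (r :: nat \<Rightarrow> nat)" "\<forall>i\<in>I. convergent (\<lambda>n. f i (r n))"
    by auto
  have "bounded (range (\<lambda>n. f j (r n)))"
    by (rule bounded_subset[OF insert.prems[of j]]) auto
  then obtain l r' where r': "strict_mono (r' :: nat \<Rightarrow> nat)" "((\<lambda>n. f j (r n)) \<circ> r') \<longlonglongrightarrow> l"
    using bounded_imp_convergent_subsequence[of "\<lambda>n. f j (r n)"] by auto
  have "convergent (\<lambda>n. f i (r (r' n)))" if "i \<in> insert j I" for i
  proof (cases "i = j")
    case True
    then show ?thesis using r'(2) by (auto simp: convergent_def o_def)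
  next
    case False
    then show ?thesis
      using that r(2) r'(1) convergent_subseq_convergent[of "\<lambda>n. f i (r n)" r'] by (auto simp: o_def)
  qed
  then show ?case
    using strict_mono_o[OF r(1) r'(1)] by (intro exI[of _ "r \<circ> r'"]) (auto simp: o_def)
qed

text \<open>The index set \<open>I\<close> is there for kernels: the conditional input laws at the
  finitely many values of \<open>Q\<close> have to converge along one common subsequence.\<close>

lemma pmf_compact:
  assumes I: "finite I" and A: "finite A" and P: "\<And>i n. i \<in> I \<Longrightarrow> set_pmf (P i n) \<subseteq> A"
  obtains r Q where "strict_mono (r :: nat \<Rightarrow> nat)"
    "\<And>i. i \<in> I \<Longrightarrow> pmf_tendsto (\<lambda>n. P i (r n)) (Q i)"
proof -
  have "\<exists>r. strict_mono (r :: nat \<Rightarrow> nat) \<and>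
      (\<forall>ix\<in>I \<times> A. convergent (\<lambda>n. (\<lambda>n. pmf (P (fst ix) n) (snd ix)) (r n)))"
    using I A
    by (intro bounded_family_subseq) (auto intro!: boundedI[of _ 1] simp: pmf_le_1)
  then obtain r where r: "strict_mono (r :: nat \<Rightarrow> nat)"
    and conv: "\<And>i x. i \<in> I \<Longrightarrow> x \<in> A \<Longrightarrow> convergent (\<lambda>n. pmf (P i (r n)) x)"
    by auto
  have "\<exists>Q. pmf_tendsto (\<lambda>n. P i (r n)) Q" if i: "i \<in> I" for i
  proof -
    define w where "w x = lim (\<lambda>n. pmf (P i (r n)) x)" for x
    have w0: "pmf (P i n) x = 0" if "x \<notin> A" for n x
      using P[OF i, of n] that by (auto simp: set_pmf_iff)
    have w: "(\<lambda>n. pmf (P i (r n)) x) \<longlonglongrightarrow> w x" for x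
    proof (cases "x \<in> A")
      case True
      then show ?thesis using conv[OF i] by (simp add: w_def convergent_LIMSEQ_iff)
    next
      case False
      then show ?thesis using w0 by (simp add: w_def)
    qed
    have w_nonneg: "w x \<ge> 0" for x
      by (rule LIMSEQ_le_const[OF w]) auto
    \<comment> \<open>Finiteness of \<open>A\<close> keeps mass from escaping, so the pointwise
      limits again sum to 1.\<close>
    have "(\<lambda>n. \<Sum>x\<in>A. pmf (P i (r n)) x) \<longlonglongrightarrow> (\<Sum>x\<in>A. w x)"
      by (intro tendsto_sum w)
    then have sum1: "(\<Sum>x\<in>A. w x) = 1"
      using P[OF i] A by (simp add: sum_pmf_eq_1 LIMSEQ_const_iff)
    have "w x = 0" if "x \<notin> A" for x
      using w0 that by (simp add: w_def)
    then have "(\<integral>\<^sup>+ t. ennreal (w t) \<partial>count_space UNIV) = (\<Sum>x\<in>A. ennreal (w x))"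
      by (intro nn_integral_count_space'[OF A]) auto
    also have "\<dots> = 1"
      using w_nonneg sum1 by (subst sum_ennreal) auto
    finally have "pmf (embed_pmf w) x = w x" for x
      by (intro pmf_embed_pmf w_nonneg)
    then show ?thesis
      using w by (intro exI[of _ "embed_pmf w"]) (simp add: pmf_tendsto_def)
  qed
  then obtain Q where "\<And>i. i \<in> I \<Longrightarrow> pmf_tendsto (\<lambda>n. P i (r n)) (Q i)"
    by metis
  with r show ?thesis using that by blast
qed

lemma pmf_compact_single:
  assumes "finite A" "\<And>n. set_pmf (P n) \<subseteq> A"
  obtains r Q where "strict_mono (r :: nat \<Rightarrow> nat)" "pmf_tendsto (\<lambda>n. P (r n)) Q"
  by (rule pmf_compact[of "{()}" A "\<lambda>_. P"]) (use assms in auto)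

lemma pmf_tendsto_bind:
  assumes A: "finite A" "\<And>n. set_pmf (P n) \<subseteq> A" and P: "pmf_tendsto P Q"
    and K: "\<And>x. x \<in> A \<Longrightarrow> pmf_tendsto (\<lambda>n. K n x) (L x)"
  shows "pmf_tendsto (\<lambda>n. bind_pmf (P n) (K n)) (bind_pmf Q L)"
  unfolding pmf_tendsto_def
proof
  fix y
  have "(\<lambda>n. \<Sum>x\<in>A. pmf (P n) x * pmf (K n x) y) \<longlonglongrightarrow> (\<Sum>x\<in>A. pmf Q x * pmf (L x) y)"
    using P K by (intro tendsto_sum tendsto_mult) (auto simp: pmf_tendsto_def)
  then show "(\<lambda>n. pmf (bind_pmf (P n) (K n)) y) \<longlonglongrightarrow> pmf (bind_pmf Q L) y"
    using A pmf_tendsto_support[OF A(2) P] by (simp add: pmf_bind expect_superset[of A])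
qed

lemma pmf_tendsto_map:
  assumes "finite A" "\<And>n. set_pmf (P n) \<subseteq> A" "pmf_tendsto P Q"
  shows "pmf_tendsto (\<lambda>n. map_pmf f (P n)) (map_pmf f Q)"
  unfolding map_pmf_def by (rule pmf_tendsto_bind[OF assms pmf_tendsto_const])

text \<open>The delicate point is 0, where the logarithm diverges but its product with x tends to 0;
  nonnegativity of the sequence makes the one-sided limit sufficient.\<close>

lemma tendsto_mult_log:
  fixes x :: real
  assumes X: "X \<longlonglongrightarrow> x" and nonneg: "\<And>n. X n \<ge> 0"
  shows "(\<lambda>n. X n * - log 2 (X n)) \<longlonglongrightarrow> x * - log 2 x"
proof (cases "x = 0")
  case False
  then show ?thesis
    using LIMSEQ_le_const[OF X] nonneg by (intro tendsto_intros X) auto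
next
  case True
  have "((\<lambda>x::real. x * - log 2 x) \<longlongrightarrow> 0) (at_right 0)"
    by real_asymp
  then have "((\<lambda>x::real. x * - log 2 x) \<longlongrightarrow> 0 * - log 2 0) (at 0 within {0..})"
    by (simp add: at_within_Ici_at_right)
  then have "continuous (at 0 within {0..}) (\<lambda>x::real. x * - log 2 x)"
    by (simp add: continuous_within)
  then show ?thesis
    unfolding True
    by (rule continuous_within_tendsto_compose') (use nonneg X True in auto)
qed

lemma entropy_tendsto:
  assumes A: "finite A" "\<And>n. set_pmf (P n) \<subseteq> A" and P: "pmf_tendsto P Q"
  shows "(\<lambda>n. entropy (P n) X) \<longlonglongrightarrow> entropy Q X"
proof -
  \<comment> \<open>The sum runs over the fixed image of \<open>A\<close> instead of the support,
    which may shrink in the limit; vanishing masses contribute 0.\<close>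
  have eq: "entropy p X = (\<Sum>v\<in>X ` A. pmf (map_pmf X p) v * - log 2 (pmf (map_pmf X p) v))"
    if "set_pmf p \<subseteq> A" for p
    using A(1) that
    by (subst expect_superset[symmetric]) (auto simp: entropy_eq_pmf simp del: mult_minus_right)
  have "(\<lambda>n. \<Sum>v\<in>X ` A. pmf (map_pmf X (P n)) v * - log 2 (pmf (map_pmf X (P n)) v)) \<longlonglongrightarrow>
      (\<Sum>v\<in>X ` A. pmf (map_pmf X Q) v * - log 2 (pmf (map_pmf X Q) v))"
    using pmf_tendsto_map[OF A P, of X]
    by (intro tendsto_sum tendsto_mult_log) (auto simp: pmf_tendsto_def)
  then show ?thesis
    using eq A(2) pmf_tendsto_support[OF A(2) P] by simp
qed

lemma cmi_tendsto:
  assumes A: "finite A" "\<And>n. set_pmf (P n) \<subseteq> A" and P: "pmf_tendsto P Q"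
  shows "(\<lambda>n. cmi (P n) X Y Z) \<longlonglongrightarrow> cmi Q X Y Z"
proof -
  have "finite (set_pmf (P n))" "finite (set_pmf Q)" for n
    using A pmf_tendsto_support[OF A(2) P] by (auto intro: finite_subset)
  then show ?thesis
    by (simp add: cmi_eq_entropy) (intro tendsto_intros entropy_tendsto[OF A P])
qed

section \<open>Time sharing\<close>

lemma entropy_mixture:
  assumes fin: "finite (set_pmf q)" "\<And>t. t \<in> set_pmf q \<Longrightarrow> finite (set_pmf (D t))"
  shows "entropy (bind_pmf q (\<lambda>t. map_pmf (Pair t) (D t))) (\<lambda>w. (V (snd w), fst w)) =
           expect q (\<lambda>t. - log 2 (pmf q t)) + expect q (\<lambda>t. entropy (D t) V)"
proof -
  let ?M = "bind_pmf q (\<lambda>t. map_pmf (Pair t) (D t))"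
  have "map_pmf (\<lambda>w. (V (snd w), fst w)) ?M = graph_pmf q (\<lambda>t. map_pmf V (D t))"
    by (simp add: graph_pmf_def map_bind_pmf map_pmf_comp)
  then have "entropy ?M (\<lambda>w. (V (snd w), fst w)) =
      expect q (\<lambda>t. expect (D t) (\<lambda>w. - log 2 (pmf q t * pmf (map_pmf V (D t)) (V w))))"
    using fin by (simp add: entropy_eq_pmf pmf_graph_pmf expect_bind)
  also have "\<dots> = expect q (\<lambda>t. - log 2 (pmf q t) + entropy (D t) V)"
  proof (rule expect_cong)
    fix t assume t: "t \<in> set_pmf q"
    have "expect (D t) (\<lambda>w. - log 2 (pmf q t * pmf (map_pmf V (D t)) (V w))) =
        expect (D t) (\<lambda>w. - log 2 (pmf q t) + - log 2 (pmf (map_pmf V (D t)) (V w)))"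
    proof (rule expect_cong)
      fix w assume "w \<in> set_pmf (D t)"
      then have "pmf (map_pmf V (D t)) (V w) > 0" "pmf q t > 0"
        using t by (auto simp: pmf_positive_iff)
      then show "- log 2 (pmf q t * pmf (map_pmf V (D t)) (V w)) =
          - log 2 (pmf q t) + - log 2 (pmf (map_pmf V (D t)) (V w))"
        by (simp add: log_mult)
    qed
    then show "expect (D t) (\<lambda>w. - log 2 (pmf q t * pmf (map_pmf V (D t)) (V w))) =
        - log 2 (pmf q t) + entropy (D t) V"
      unfolding expect_add[OF fin(2)[OF t]] by (simp add: entropy_eq_pmf)
  qed
  also have "\<dots> = expect q (\<lambda>t. - log 2 (pmf q t)) + expect q (\<lambda>t. entropy (D t) V)"
    by (rule expect_add[OF fin(1)])
  finally show ?thesis .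
qed

text \<open>The entropy of the mixing variable occurs in all four entropies, twice with each sign,
  and cancels. What remains is an average over that variable, hence linear in its law.\<close>

lemma cmi_mixture:
  assumes fin: "finite (set_pmf q)" "\<And>t. t \<in> set_pmf q \<Longrightarrow> finite (set_pmf (D t))"
  shows "cmi (bind_pmf q (\<lambda>t. map_pmf (Pair t) (D t)))
           (\<lambda>w. X (snd w)) (\<lambda>w. Y (snd w)) (\<lambda>w. (Z (snd w), fst w)) =
         expect q (\<lambda>t. cmi (D t) X Y Z)"
proof -
  let ?M = "bind_pmf q (\<lambda>t. map_pmf (Pair t) (D t))"
  have finM: "finite (set_pmf ?M)"
    using fin by auto
  note mix = entropy_mixture[of q D, OF fin]
  have "entropy ?M (\<lambda>w. (X (snd w), Z (snd w), fst w)) = entropy ?M (\<lambda>w. ((X (snd w), Z (snd w)), fst w))"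
    by (rule entropy_cong) auto
  moreover have "entropy ?M (\<lambda>w. (Y (snd w), Z (snd w), fst w)) =
      entropy ?M (\<lambda>w. ((Y (snd w), Z (snd w)), fst w))"
    by (rule entropy_cong) auto
  moreover have "entropy ?M (\<lambda>w. (X (snd w), Y (snd w), Z (snd w), fst w)) =
      entropy ?M (\<lambda>w. ((X (snd w), Y (snd w), Z (snd w)), fst w))"
    by (rule entropy_cong) auto
  ultimately have "cmi ?M (\<lambda>w. X (snd w)) (\<lambda>w. Y (snd w)) (\<lambda>w. (Z (snd w), fst w)) =
      expect q (\<lambda>t. entropy (D t) (\<lambda>w. (X w, Z w))) + expect q (\<lambda>t. entropy (D t) (\<lambda>w. (Y w, Z w))) -
      expect q (\<lambda>t. entropy (D t) (\<lambda>w. (X w, Y w, Z w))) - expect q (\<lambda>t. entropy (D t) Z)"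
    using mix[of "\<lambda>w. (X w, Z w)"] mix[of "\<lambda>w. (Y w, Z w)"] mix[of "\<lambda>w. (X w, Y w, Z w)"] mix[of Z]
    by (simp add: cmi_eq_entropy[OF finM])
  also have "\<dots> = expect q (\<lambda>t. entropy (D t) (\<lambda>w. (X w, Z w)) + entropy (D t) (\<lambda>w. (Y w, Z w)) -
      entropy (D t) (\<lambda>w. (X w, Y w, Z w)) - entropy (D t) Z)"
    using fin(1) by (simp only: expect_add expect_diff)
  also have "\<dots> = expect q (\<lambda>t. cmi (D t) X Y Z)"
    by (rule expect_cong) (simp add: cmi_eq_entropy fin(2))
  finally show ?thesis .
qed

section \<open>From a code to input laws common to all cuts\<close>

lemma phase1_dist_eq: "phase1_dist q pxa pxb p1 = bind_pmf q (\<lambda>t. map_pmf (Pair t) (mac_pmf (pxa t) (pxb t) p1))"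
  by (simp add: phase1_dist_def mac_pmf_def map_bind_pmf map_pmf_comp)

lemma phase2_dist_eq: "phase2_dist px p2 = chan_pmf px p2"
proof -
  have "(\<lambda>(ya, yb). (x, ya, yb)) = Pair x" for x :: 'a
    by auto
  then show ?thesis
    by (simp add: phase2_dist_def chan_pmf_def)
qed

text \<open>Together with \<open>joint_pmf_swap\<close> this exchanges the two terminals, so that
  the bound for one direction also yields the other.\<close>

lemma mac_pmf_swap:
  "mac_pmf pb pa (\<lambda>b a. p1 a b) = map_pmf (\<lambda>(a, b, y). (b, a, y)) (mac_pmf pa pb p1)"
  unfolding mac_pmf_def
  by (subst bind_commute_pmf) (simp add: map_bind_pmf map_pmf_comp)

lemma joint_pmf_swap:
  "joint_pmf M2 M1 (\<lambda>w2 w1. k1 w1 w2) k2 =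
     map_pmf (\<lambda>(w1, w2, u, v). (w2, w1, u, v)) (joint_pmf M1 M2 k1 k2)"
  unfolding joint_pmf_def
  by (subst bind_commute_pmf) (simp add: map_bind_pmf map_pmf_comp)

text \<open>Replaces the uniform time index by a law on few time indices. For \<open>n = 0\<close>
  there is no uniform law, and any point mass will do because both sides are 0.\<close>

lemma caratheodory_average:
  fixes f :: "'j \<Rightarrow> nat \<Rightarrow> real"
  assumes J: "finite J"
  obtains q where "finite (set_pmf q)" "card (set_pmf q) \<le> card J + 1"
    "\<And>j. j \<in> J \<Longrightarrow> (\<Sum>k<n. f j k) = real n * expect q (f j)"
proof (cases "n > 0")
  case True
  obtain q where q: "set_pmf q \<subseteq> set_pmf (pmf_of_set {..<n})" "card (set_pmf q) \<le> card J + 1"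
    "\<forall>j\<in>J. expect q (f j) = expect (pmf_of_set {..<n}) (f j)"
    using caratheodory_pmf[OF J, of "pmf_of_set {..<n}" f] True by (auto simp: pmf_of_set_lessThan)
  then have "finite (set_pmf q)"
    using True by (auto simp: pmf_of_set_lessThan intro: finite_subset)
  with q show ?thesis
    using True by (intro that[of q]) (auto simp: expect_pmf_of_set_lessThan)
next
  case False
  then show ?thesis
    by (intro that[of "return_pmf 0"]) auto
qed

lemma mabc_run_eq_joint:
  "mabc_run m p1 p2 Ma Mb c = map_pmf (\<lambda>(wa, wb, u, v). (wa, wb, dec_b c wb (map snd v), dec_a c wa (map fst v)))
     (joint_pmf Ma Mb (\<lambda>wa wb. seq_pmf (map (\<lambda>k. p1 (enc_a c wa k) (enc_b c wb k)) [0..<c_n1 c]))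
       (\<lambda>u. seq_pmf (map (\<lambda>k. p2 (\<lambda>r. if r < m then relay_enc c r k (map (\<lambda>y. y r) u) else undefined))
         [0..<c_n2 c])))"
  by (simp add: mabc_run_def joint_pmf_def map_bind_pmf map_pmf_comp)
    (simp add: map_pmf_def)

text \<open>The suffix names the transmitting terminal in \<open>mac_info\<close> and the receiving
  one in \<open>bc_info\<close>, so \<open>Ra\<close> is bounded by \<open>mac_info_a\<close>
  together with \<open>bc_info_b\<close>.\<close>

definition mac_info_a :: "nat \<Rightarrow> nat set \<Rightarrow> ('q \<times> 'xa \<times> 'xb \<times> (nat \<Rightarrow> 'yr)) pmf \<Rightarrow> real" where
  "mac_info_a m S P = cmi P (\<lambda>(t, xa, xb, y). xa) (\<lambda>(t, xa, xb, y). restrict y ({..<m} - S))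
     (\<lambda>(t, xa, xb, y). (xb, t))"

definition mac_info_b :: "nat \<Rightarrow> nat set \<Rightarrow> ('q \<times> 'xa \<times> 'xb \<times> (nat \<Rightarrow> 'yr)) pmf \<Rightarrow> real" where
  "mac_info_b m S P = cmi P (\<lambda>(t, xa, xb, y). xb) (\<lambda>(t, xa, xb, y). restrict y ({..<m} - S))
     (\<lambda>(t, xa, xb, y). (xa, t))"

definition bc_info_a :: "nat \<Rightarrow> nat set \<Rightarrow> ((nat \<Rightarrow> 'xr) \<times> 'ya \<times> 'yb) pmf \<Rightarrow> real" where
  "bc_info_a m S P = cmi P (\<lambda>(x, ya, yb). restrict x S) (\<lambda>(x, ya, yb). ya)
     (\<lambda>(x, ya, yb). restrict x ({..<m} - S))"

definition bc_info_b :: "nat \<Rightarrow> nat set \<Rightarrow> ((nat \<Rightarrow> 'xr) \<times> 'ya \<times> 'yb) pmf \<Rightarrow> real" where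
  "bc_info_b m S P = cmi P (\<lambda>(x, ya, yb). restrict x S) (\<lambda>(x, ya, yb). yb)
     (\<lambda>(x, ya, yb). restrict x ({..<m} - S))"

lemma restrict_eq_iff: "restrict f A = restrict g A \<longleftrightarrow> (\<forall>x\<in>A. f x = g x)"
  by (auto simp: restrict_def fun_eq_iff)

lemma mac_info_phase1_dist:
  assumes "finite (set_pmf q)"
    and fin: "\<And>t. t \<in> set_pmf q \<Longrightarrow> finite (set_pmf (mac_pmf (pxa t) (pxb t) p1))"
  shows "mac_info_a m S (phase1_dist q pxa pxb p1) = expect q (\<lambda>t. cmi (mac_pmf (pxa t) (pxb t) p1)
            (\<lambda>(a, b, y). a) (\<lambda>(a, b, y). restrict y ({..<m} - S)) (\<lambda>(a, b, y). b))"
    and "mac_info_b m S (phase1_dist q pxa pxb p1) = expect q (\<lambda>t. cmi (mac_pmf (pxa t) (pxb t) p1)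
            (\<lambda>(a, b, y). b) (\<lambda>(a, b, y). restrict y ({..<m} - S)) (\<lambda>(a, b, y). a))"
  unfolding mac_info_a_def mac_info_b_def phase1_dist_eq
  by (subst cmi_mixture[symmetric]; simp add: assms case_prod_beta')+

text \<open>Restriction to the empty set is the constant function \<open>undefined\<close>: with
  every relay on the transmitting side, phase 1 delivers nothing across the cut.\<close>

lemma cmi_full_cut:
  assumes "finite (set_pmf P)"
  shows "cmi P X (\<lambda>(a, b, y). restrict y ({..<m} - {..<m})) Z = 0"
  using cmi_const[OF assms, of X "\<lambda>_. undefined" Z] by (simp add: restrict_def case_prod_beta')

text \<open>The quantifier order is the point: one choice of \<open>q\<close>, \<open>pxa\<close>,
  \<open>pxb\<close>, \<open>px\<close> precedes all cuts and both directions. The alphabet of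
  \<open>q\<close> does not depend on the block length.\<close>

lemma code_single_letter:
  fixes p1 :: "'xa \<Rightarrow> 'xb \<Rightarrow> (nat \<Rightarrow> 'yr) pmf"
    and p2 :: "(nat \<Rightarrow> 'xr) \<Rightarrow> ('ya \<times> 'yb) pmf"
    and c :: "('xa, 'xb, 'xr, 'yr, 'ya, 'yb) mabc_code"
  assumes fin1: "\<And>xa xb. xa \<in> Xa \<Longrightarrow> xb \<in> Xb \<Longrightarrow> finite (set_pmf (p1 xa xb))"
    and fin2: "\<And>x. x \<in> PiE {..<m} Xr \<Longrightarrow> finite (set_pmf (p2 x))"
    and valid: "valid_mabc_code m Xa Xb Xr n c"
    and M: "Ma > 0" "Mb > 0"
  shows "\<exists>(q :: nat pmf) pxa pxb px. set_pmf q \<subseteq> {..<2 ^ (m + 1)} \<and>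
     (\<forall>t. set_pmf (pxa t) \<subseteq> Xa \<and> set_pmf (pxb t) \<subseteq> Xb) \<and> set_pmf px \<subseteq> PiE {..<m} Xr \<and>
     (\<forall>S\<subseteq>{..<m}.
       (1 - measure_pmf.prob (mabc_run m p1 p2 Ma Mb c) {(wa, wb, wa', wb'). wa' \<noteq> wa}) * log 2 (real Ma) - 1 \<le>
         real (c_n1 c) * mac_info_a m S (phase1_dist q pxa pxb p1) +
         real (c_n2 c) * bc_info_b m S (phase2_dist px p2) \<and>
       (1 - measure_pmf.prob (mabc_run m p1 p2 Ma Mb c) {(wa, wb, wa', wb'). wb' \<noteq> wb}) * log 2 (real Mb) - 1 \<le>
         real (c_n1 c) * mac_info_b m S (phase1_dist q pxa pxb p1) +
         real (c_n2 c) * bc_info_a m S (phase2_dist px p2))"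
proof -
  have encX: "enc_a c w k \<in> Xa" "enc_b c w k \<in> Xb" for w k
    using valid by (auto simp: valid_mabc_code_def)
  define x where "x k u = (\<lambda>r. if r < m then relay_enc c r k (map (\<lambda>y. y r) u) else undefined)" for k u
  have xX: "x k u \<in> PiE {..<m} Xr" for k u
    using valid by (auto simp: x_def valid_mabc_code_def split: if_splits)
  define J where "J = joint_pmf Ma Mb (\<lambda>wa wb. seq_pmf (map (\<lambda>k. p1 (enc_a c wa k) (enc_b c wb k)) [0..<c_n1 c]))
       (\<lambda>u. seq_pmf (map (\<lambda>k. p2 (x k u)) [0..<c_n2 c]))"
  define J' where "J' = joint_pmf Mb Ma (\<lambda>wb wa. seq_pmf (map (\<lambda>k. p1 (enc_a c wa k) (enc_b c wb k)) [0..<c_n1 c]))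
       (\<lambda>u. seq_pmf (map (\<lambda>k. p2 (x k u)) [0..<c_n2 c]))"
  have J'_swap: "J' = map_pmf (\<lambda>(w1, w2, u, v). (w2, w1, u, v)) J"
    unfolding J_def J'_def by (rule joint_pmf_swap)
  have run: "mabc_run m p1 p2 Ma Mb c =
      map_pmf (\<lambda>(wa, wb, u, v). (wa, wb, dec_b c wb (map snd v), dec_a c wa (map fst v))) J"
    unfolding mabc_run_eq_joint J_def x_def ..
  have err_a: "measure_pmf.prob (mabc_run m p1 p2 Ma Mb c) {(wa, wb, wa', wb'). wa' \<noteq> wa} =
      measure_pmf.prob J {(w1, w2, u, v). dec_b c w2 (map snd v) \<noteq> w1}"
    by (auto simp: run intro!: arg_cong2[where f = measure])
  have err_b: "measure_pmf.prob (mabc_run m p1 p2 Ma Mb c) {(wa, wb, wa', wb'). wb' \<noteq> wb} =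
      measure_pmf.prob J' {(w1, w2, u, v). dec_a c w2 (map fst v) \<noteq> w1}"
    by (auto simp: run J'_swap intro!: arg_cong2[where f = measure])

  \<comment> \<open>Without phase-2 uses there is nothing to average; any law on the input alphabet
    serves, since its information is multiplied by 0.\<close>
  define px where "px = (if c_n2 c > 0
    then bind_pmf (pmf_of_set {..<c_n2 c}) (\<lambda>k. map_pmf (\<lambda>(w1, w2, u, v). x k u) J)
    else return_pmf (x 0 []))"
  have px: "set_pmf px \<subseteq> PiE {..<m} Xr"
    using xX by (auto simp: px_def)
  have px_J: "c_n2 c > 0 \<Longrightarrow> px = bind_pmf (pmf_of_set {..<c_n2 c}) (\<lambda>k. map_pmf (\<lambda>(w1, w2, u, v). x k u) J)"
    by (simp add: px_def)
  then have px_J': "c_n2 c > 0 \<Longrightarrow> px = bind_pmf (pmf_of_set {..<c_n2 c}) (\<lambda>k. map_pmf (\<lambda>(w1, w2, u, v). x k u) J')"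
    by (simp add: J'_swap map_pmf_comp case_prod_beta')

  define pa where "pa k = map_pmf (\<lambda>w. enc_a c w k) (pmf_of_set {..<Ma})" for k
  define pb where "pb k = map_pmf (\<lambda>w. enc_b c w k) (pmf_of_set {..<Mb})" for k
  have paX: "set_pmf (pa k) \<subseteq> Xa" "set_pmf (pb k) \<subseteq> Xb" for k
    using encX by (auto simp: pa_def pb_def)
  have fin_mac: "finite (set_pmf (mac_pmf (pa k) (pb k) p1))" for k
    using fin1 encX M by (auto simp: mac_pmf_def pa_def pb_def pmf_of_set_lessThan)
  define fa where "fa S k = cmi (mac_pmf (pa k) (pb k) p1)
      (\<lambda>(a, b, y). a) (\<lambda>(a, b, y). restrict y ({..<m} - S)) (\<lambda>(a, b, y). b)" for S k
  define fb where "fb S k = cmi (mac_pmf (pa k) (pb k) p1)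
      (\<lambda>(a, b, y). b) (\<lambda>(a, b, y). restrict y ({..<m} - S)) (\<lambda>(a, b, y). a)" for S k

  have bounds: "(1 - measure_pmf.prob (mabc_run m p1 p2 Ma Mb c) {(wa, wb, wa', wb'). wa' \<noteq> wa}) * log 2 (real Ma) - 1
        \<le> (\<Sum>k<c_n1 c. fa S k) + real (c_n2 c) * bc_info_b m S (phase2_dist px p2)"
      "(1 - measure_pmf.prob (mabc_run m p1 p2 Ma Mb c) {(wa, wb, wa', wb'). wb' \<noteq> wb}) * log 2 (real Mb) - 1
        \<le> (\<Sum>k<c_n1 c. fb S k) + real (c_n2 c) * bc_info_a m S (phase2_dist px p2)"
    if S: "S \<subseteq> {..<m}" for S
  proof -
    define rk where "rk k ys = restrict (\<lambda>r. relay_enc c r k (map (\<lambda>y. y r) ys)) ({..<m} - S)"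
      for k and ys :: "(nat \<Rightarrow> 'yr) list"
    \<comment> \<open>A relay outside \<open>S\<close> encodes from its own coordinate
      \<open>y r\<close>, which restriction to \<open>{..<m} - S\<close> keeps.\<close>
    have causal: "restrict (x k u) ({..<m} - S) = rk k (map (\<lambda>y. restrict y ({..<m} - S)) u)" for k u
      by (auto simp: rk_def x_def fun_eq_iff restrict_def o_def)
    have inj: "x k u = x k' u'" if "restrict (x k u) ({..<m} - S) = restrict (x k' u') ({..<m} - S)"
      "restrict (x k u) S = restrict (x k' u') S" for k u k' u'
    proof (rule PiE_ext[OF xX xX])
      fix r assume "r \<in> {..<m}"
      then show "x k u r = x k' u' r"
        using that unfolding restrict_eq_iff by (cases "r \<in> S") auto
    qed
    show "(1 - measure_pmf.prob (mabc_run m p1 p2 Ma Mb c) {(wa, wb, wa', wb'). wa' \<noteq> wa}) * log 2 (real Ma) - 1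
        \<le> (\<Sum>k<c_n1 c. fa S k) + real (c_n2 c) * bc_info_b m S (phase2_dist px p2)"
    proof -
      have "(1 - measure_pmf.prob J {(w1, w2, u, v). dec_b c w2 (map snd v) \<noteq> w1}) * log 2 (real Ma) - 1 \<le>
          (\<Sum>k<c_n1 c. cmi (mac_pmf (pa k) (pb k) p1)
            (\<lambda>(a, b, y). a) (\<lambda>(a, b, y). restrict y ({..<m} - S)) (\<lambda>(a, b, y). b)) +
          real (c_n2 c) * cmi (chan_pmf px p2) (\<lambda>(x, y). restrict x S) (\<lambda>(x, y). snd y)
            (\<lambda>(x, y). restrict x ({..<m} - S))"
        unfolding J_def pa_def pb_def
        by (rule code_bound[where x = x and h = "\<lambda>y. restrict y ({..<m} - S)" and g = snd
              and r = "\<lambda>x. restrict x ({..<m} - S)" and s = "\<lambda>x. restrict x S" and rk = rk and d = "dec_b c"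
              and ?e1.0 = "enc_a c" and ?e2.0 = "enc_b c"])
            (rule M fin1[OF encX] fin2[OF xX] causal px_J[unfolded J_def] | erule (1) inj | assumption)+
      then show ?thesis
        unfolding err_a phase2_dist_eq bc_info_b_def fa_def by (simp only: case_prod_beta')
    qed
    show "(1 - measure_pmf.prob (mabc_run m p1 p2 Ma Mb c) {(wa, wb, wa', wb'). wb' \<noteq> wb}) * log 2 (real Mb) - 1
        \<le> (\<Sum>k<c_n1 c. fb S k) + real (c_n2 c) * bc_info_a m S (phase2_dist px p2)"
    proof -
      have "(1 - measure_pmf.prob J' {(w1, w2, u, v). dec_a c w2 (map fst v) \<noteq> w1}) * log 2 (real Mb) - 1 \<le>
          (\<Sum>k<c_n1 c. cmi (mac_pmf (pb k) (pa k) (\<lambda>b a. p1 a b))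
            (\<lambda>(a, b, y). a) (\<lambda>(a, b, y). restrict y ({..<m} - S)) (\<lambda>(a, b, y). b)) +
          real (c_n2 c) * cmi (chan_pmf px p2) (\<lambda>(x, y). restrict x S) (\<lambda>(x, y). fst y)
            (\<lambda>(x, y). restrict x ({..<m} - S))"
        unfolding J'_def pa_def pb_def
        by (rule code_bound[where x = x and h = "\<lambda>y. restrict y ({..<m} - S)" and g = fst
              and r = "\<lambda>x. restrict x ({..<m} - S)" and s = "\<lambda>x. restrict x S" and rk = rk and d = "dec_a c"
              and ?e1.0 = "enc_b c" and ?e2.0 = "enc_a c"])
            (rule M fin1[OF encX] fin2[OF xX] causal px_J'[unfolded J'_def] | erule (1) inj | assumption)+
      then show ?thesis
        unfolding err_b phase2_dist_eq bc_info_a_def fb_def mac_pmf_swap[of "pb _" "pa _" p1] cmi_map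
        by (simp only: case_prod_beta' fst_conv snd_conv)
    qed
  qed

  \<comment> \<open>The boolean selects the direction of transmission.\<close>
  let ?I = "(Pow {..<m} - {{..<m}}) \<times> (UNIV :: bool set)"
  obtain q where q: "finite (set_pmf q)" "card (set_pmf q) \<le> card ?I + 1"
    and avg: "\<And>j. j \<in> ?I \<Longrightarrow> (\<Sum>k<c_n1 c. (if snd j then fa (fst j) k else fb (fst j) k)) =
      real (c_n1 c) * expect q (\<lambda>k. if snd j then fa (fst j) k else fb (fst j) k)"
    using caratheodory_average[of ?I "\<lambda>j k. if snd j then fa (fst j) k else fb (fst j) k" "c_n1 c"]
    by auto
  have sum: "(\<Sum>k<c_n1 c. fa S k) = real (c_n1 c) * expect q (fa S)"
    "(\<Sum>k<c_n1 c. fb S k) = real (c_n1 c) * expect q (fb S)" if "S \<subseteq> {..<m}" for S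
  proof -
    have full: "fa {..<m} = (\<lambda>_. 0)" "fb {..<m} = (\<lambda>_. 0)"
      unfolding fa_def fb_def by (rule ext, rule cmi_full_cut[OF fin_mac])+
    show "(\<Sum>k<c_n1 c. fa S k) = real (c_n1 c) * expect q (fa S)"
    proof (cases "S = {..<m}")
      case False
      then show ?thesis using avg[of "(S, True)"] that by simp
    qed (simp add: full)
    show "(\<Sum>k<c_n1 c. fb S k) = real (c_n1 c) * expect q (fb S)"
    proof (cases "S = {..<m}")
      case False
      then show ?thesis using avg[of "(S, False)"] that by simp
    qed (simp add: full)
  qed
  \<comment> \<open>Proper cuts times directions; with the extra point from normalization this gives
    \<open>2 ^ (m + 1) - 1\<close>, one below the stated bound.\<close>
  have "card ?I = (2 ^ m - 1) * 2"
    by (simp add: card_cartesian_product card_Pow card_Diff_singleton)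
  with q(2) have "card (set_pmf q) \<le> (2 ^ m - 1) * 2 + 1"
    by (simp only:)
  moreover have "(2 ^ m - 1) * 2 + 1 \<le> (2::nat) ^ (m + 1)"
    by (cases "(2::nat) ^ m") simp_all
  ultimately have card: "card (set_pmf q) \<le> 2 ^ (m + 1)"
    by (rule order_trans)

  \<comment> \<open>The support of \<open>q\<close> consists of time indices, which move with the
    code. Relabelling it by an initial segment gives all block lengths the same alphabet. Off that
    segment \<open>pre\<close> is arbitrary, but \<open>pa\<close> and \<open>pb\<close> have
    supports in \<open>Xa\<close> and \<open>Xb\<close> at every index.\<close>
  obtain idx where idx: "bij_betw idx (set_pmf q) {..<card (set_pmf q)}"
    using ex_bij_betw_finite_nat[OF q(1)] by (auto simp: atLeast0LessThan)
  define pre where "pre = inv_into (set_pmf q) idx"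
  have pre: "pre (idx k) = k" if "k \<in> set_pmf q" for k
    using idx that by (simp add: pre_def bij_betw_def)
  define q' where "q' = map_pmf idx q"
  have q': "set_pmf q' \<subseteq> {..<2 ^ (m + 1)}"
    using idx card by (auto simp: q'_def bij_betw_def)
  have info: "mac_info_a m S (phase1_dist q' (\<lambda>t. pa (pre t)) (\<lambda>t. pb (pre t)) p1) = expect q (fa S)"
    "mac_info_b m S (phase1_dist q' (\<lambda>t. pa (pre t)) (\<lambda>t. pb (pre t)) p1) = expect q (fb S)" for S
    using q(1)
    by (subst mac_info_phase1_dist; auto simp: q'_def fin_mac pre fa_def fb_def intro!: expect_cong)+
  show ?thesis
    by (intro exI[of _ q'] exI[of _ "\<lambda>t. pa (pre t)"] exI[of _ "\<lambda>t. pb (pre t)"] exI[of _ px])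
      (use q' paX px bounds sum info in auto)
qed

section \<open>Passage to the limit\<close>

text \<open>Rounding down a number that is at least 1 loses at most a factor 2, hence at most one
  bit, which vanishes after division by \<open>n\<close>.\<close>

lemma log_msg_size_bounds:
  assumes "R \<ge> 0"
  shows "real n * R - 1 \<le> log 2 (real (msg_size n R))" "log 2 (real (msg_size n R)) \<le> real n * R"
    "msg_size n R > 0"
proof -
  let ?x = "2 powr (real n * R)"
  have x: "?x \<ge> 1"
    using assms by (simp add: ge_one_powr_ge_zero)
  then have fl: "\<lfloor>?x\<rfloor> \<ge> 1"
    by simp
  then have M: "real (msg_size n R) = of_int \<lfloor>?x\<rfloor>"
    by (simp add: msg_size_def)
  show "msg_size n R > 0"
    using fl by (simp add: msg_size_def)
  have "?x / 2 \<le> of_int \<lfloor>?x\<rfloor>"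
    using fl by linarith
  then have "log 2 (?x / 2) \<le> log 2 (real (msg_size n R))"
    using x M by (intro log_mono) auto
  then show "real n * R - 1 \<le> log 2 (real (msg_size n R))"
    by (simp add: log_divide)
  have "log 2 (real (msg_size n R)) \<le> log 2 ?x"
    using fl M by (intro log_mono) auto
  then show "log 2 (real (msg_size n R)) \<le> real n * R"
    by simp
qed

lemma rate_tendsto:
  assumes "R \<ge> 0" "err \<longlonglongrightarrow> 0"
  shows "(\<lambda>n. ((1 - err n) * log 2 (real (msg_size n R)) - 1) / real n) \<longlonglongrightarrow> R"
proof -
  have "(\<lambda>n. R - 1 / real n) \<longlonglongrightarrow> R - 0"
    by (intro tendsto_diff tendsto_const lim_1_over_n)
  then have lower: "(\<lambda>n. R - 1 / real n) \<longlonglongrightarrow> R" by simp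
  have log: "(\<lambda>n. log 2 (real (msg_size n R)) / real n) \<longlonglongrightarrow> R"
  proof (rule tendsto_sandwich[OF _ _ lower tendsto_const])
    show "\<forall>\<^sub>F n in sequentially. R - 1 / real n \<le> log 2 (real (msg_size n R)) / real n"
      using eventually_gt_at_top[of 0]
    proof eventually_elim
      case (elim n)
      then show ?case
        using divide_right_mono[OF log_msg_size_bounds(1)[OF assms(1), of n], of "real n"]
        by (simp add: diff_divide_distrib)
    qed
    show "\<forall>\<^sub>F n in sequentially. log 2 (real (msg_size n R)) / real n \<le> R"
      using eventually_gt_at_top[of 0]
    proof eventually_elim
      case (elim n)
      then show ?case
        using log_msg_size_bounds(2)[OF assms(1), of n] by (simp add: field_simps)
    qed
  qed
  have "(\<lambda>n. (1 - err n) * (log 2 (real (msg_size n R)) / real n) - 1 / real n) \<longlonglongrightarrow> (1 - 0) * R - 0"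
    by (intro tendsto_intros assms log lim_1_over_n)
  then show ?thesis
    by (simp add: diff_divide_distrib)
qed

lemma phase1_dist_tendsto:
  fixes N :: nat
  assumes Xa: "finite Xa" and Xb: "finite Xb"
    and q: "\<And>n. set_pmf (q n) \<subseteq> {..<N}" "pmf_tendsto q q'"
    and pa: "\<And>n t. set_pmf (pa n t) \<subseteq> Xa" "\<And>t. t < N \<Longrightarrow> pmf_tendsto (\<lambda>n. pa n t) (pa' t)"
    and pb: "\<And>n t. set_pmf (pb n t) \<subseteq> Xb" "\<And>t. t < N \<Longrightarrow> pmf_tendsto (\<lambda>n. pb n t) (pb' t)"
  shows "pmf_tendsto (\<lambda>n. phase1_dist (q n) (pa n) (pb n) p1) (phase1_dist q' pa' pb' p1)"
  unfolding phase1_dist_def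
  by (intro pmf_tendsto_bind[where A = "{..<N}"] pmf_tendsto_bind[where A = Xa]
      pmf_tendsto_bind[where A = Xb] pmf_tendsto_const) (use assms in auto)

lemma phase2_dist_tendsto:
  assumes "finite A" "\<And>n. set_pmf (px n) \<subseteq> A" "pmf_tendsto px px'"
  shows "pmf_tendsto (\<lambda>n. phase2_dist (px n) p2) (phase2_dist px' p2)"
  unfolding phase2_dist_def by (intro pmf_tendsto_bind[OF assms] pmf_tendsto_const)

text \<open>Durations and error probabilities converge along all lengths, the information terms only
  along \<open>r\<close>; a single subsequence suffices because the limiting rate does not depend on
  it.\<close>

lemma rate_limit:
  assumes R: "R \<ge> 0" "err \<longlonglongrightarrow> 0" and r: "strict_mono r"
    and n1: "(\<lambda>n. real (n1 n) / real n) \<longlonglongrightarrow> \<Delta>1" and n2: "(\<lambda>n. real (n2 n) / real n) \<longlonglongrightarrow> \<Delta>2"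
    and I: "(\<lambda>n. I1 (r n)) \<longlonglongrightarrow> i1" "(\<lambda>n. I2 (r n)) \<longlonglongrightarrow> i2"
    and le: "\<And>n. (1 - err n) * log 2 (real (msg_size n R)) - 1 \<le> real (n1 n) * I1 n + real (n2 n) * I2 n"
  shows "R \<le> \<Delta>1 * i1 + \<Delta>2 * i2"
proof (rule LIMSEQ_le)
  show "(\<lambda>n. ((1 - err (r n)) * log 2 (real (msg_size (r n) R)) - 1) / real (r n)) \<longlonglongrightarrow> R"
    using LIMSEQ_subseq_LIMSEQ[OF rate_tendsto[OF R] r] by (simp add: o_def)
  show "(\<lambda>n. real (n1 (r n)) / real (r n) * I1 (r n) + real (n2 (r n)) / real (r n) * I2 (r n))
      \<longlonglongrightarrow> \<Delta>1 * i1 + \<Delta>2 * i2"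
    using LIMSEQ_subseq_LIMSEQ[OF n1 r] LIMSEQ_subseq_LIMSEQ[OF n2 r]
    by (intro tendsto_intros I) (simp_all add: o_def)
  \<comment> \<open>Also true at \<open>n = 0\<close>, where both sides are \<open>0\<close> because \<open>x / 0 = 0\<close>.\<close>
  have "((1 - err n) * log 2 (real (msg_size n R)) - 1) / real n \<le>
      real (n1 n) / real n * I1 n + real (n2 n) / real n * I2 n" for n
    using divide_right_mono[OF le[of n], of "real n"] by (simp add: add_divide_distrib)
  then show "\<exists>k. \<forall>n\<ge>k. ((1 - err (r n)) * log 2 (real (msg_size (r n) R)) - 1) / real (r n) \<le>
      real (n1 (r n)) / real (r n) * I1 (r n) + real (n2 (r n)) / real (r n) * I2 (r n)"
    by blast
qed

theorem theorem7:
  fixes m :: nat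
    and Xa :: "'xa set" and Xb :: "'xb set" and Xr :: "nat \<Rightarrow> 'xr set"
    and Yr :: "nat \<Rightarrow> 'yr set" and Ya :: "'ya set" and Yb :: "'yb set"
    and p1 :: "'xa \<Rightarrow> 'xb \<Rightarrow> (nat \<Rightarrow> 'yr) pmf"
    and p2 :: "(nat \<Rightarrow> 'xr) \<Rightarrow> ('ya \<times> 'yb) pmf"
    and \<Delta>1 \<Delta>2 Ra Rb :: real
  assumes "finite Xa" "Xa \<noteq> {}" "finite Xb" "Xb \<noteq> {}"
    and "\<forall>r<m. finite (Xr r) \<and> Xr r \<noteq> {}" "\<forall>r<m. finite (Yr r) \<and> Yr r \<noteq> {}"
    and "finite Ya" "Ya \<noteq> {}" "finite Yb" "Yb \<noteq> {}"
    and "\<forall>xa\<in>Xa. \<forall>xb\<in>Xb. set_pmf (p1 xa xb) \<subseteq> PiE {..<m} Yr"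
    and "\<forall>x\<in>PiE {..<m} Xr. set_pmf (p2 x) \<subseteq> Ya \<times> Yb"
    and "\<Delta>1 \<ge> 0" "\<Delta>2 \<ge> 0" "\<Delta>1 + \<Delta>2 = 1"
    and "mabc_achievable m Xa Xb Xr p1 p2 \<Delta>1 \<Delta>2 Ra Rb"
  shows "\<exists>(q :: nat pmf) (pxa :: nat \<Rightarrow> 'xa pmf) (pxb :: nat \<Rightarrow> 'xb pmf)
            (px :: (nat \<Rightarrow> 'xr) pmf).
     finite (set_pmf q) \<and> card (set_pmf q) \<le> 2 ^ (m + 1) \<and>
     (\<forall>t\<in>set_pmf q. set_pmf (pxa t) \<subseteq> Xa \<and> set_pmf (pxb t) \<subseteq> Xb) \<and>
     set_pmf px \<subseteq> PiE {..<m} Xr \<and>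
     (\<forall>S \<subseteq> {..<m}.
        Ra \<le> \<Delta>1 * cmi (phase1_dist q pxa pxb p1)
                         (\<lambda>(t, xa, xb, y). xa)
                         (\<lambda>(t, xa, xb, y). restrict y ({..<m} - S))
                         (\<lambda>(t, xa, xb, y). (xb, t))
            + \<Delta>2 * cmi (phase2_dist px p2)
                         (\<lambda>(x, ya, yb). restrict x S)
                         (\<lambda>(x, ya, yb). yb)
                         (\<lambda>(x, ya, yb). restrict x ({..<m} - S)) \<and>
        Rb \<le> \<Delta>1 * cmi (phase1_dist q pxa pxb p1)
                         (\<lambda>(t, xa, xb, y). xb)
                         (\<lambda>(t, xa, xb, y). restrict y ({..<m} - S))
                         (\<lambda>(t, xa, xb, y). (xa, t))
            + \<Delta>2 * cmi (phase2_dist px p2)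
                         (\<lambda>(x, ya, yb). restrict x S)
                         (\<lambda>(x, ya, yb). ya)
                         (\<lambda>(x, ya, yb). restrict x ({..<m} - S)))"
proof -
  let ?N = "2 ^ (m + 1) :: nat" and ?X = "PiE {..<m} Xr"
  have finX: "finite ?X"
    using assms(5) by (intro finite_PiE) auto
  have finY: "finite (PiE {..<m} Yr)"
    using assms(6) by (intro finite_PiE) auto
  have fin1: "finite (set_pmf (p1 xa xb))" if "xa \<in> Xa" "xb \<in> Xb" for xa xb
    using assms(11) that finY by (meson finite_subset)
  have fin2: "finite (set_pmf (p2 x))" if "x \<in> ?X" for x
    using assms(12) that assms(7,9) by (meson finite_subset finite_SigmaI)
  obtain C :: "nat \<Rightarrow> ('xa, 'xb, 'xr, 'yr, 'ya, 'yb) mabc_code" where R: "Ra \<ge> 0" "Rb \<ge> 0"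
    and valid: "\<And>n. valid_mabc_code m Xa Xb Xr n (C n)"
    and n1: "(\<lambda>n. real (c_n1 (C n)) / real n) \<longlonglongrightarrow> \<Delta>1"
    and n2: "(\<lambda>n. real (c_n2 (C n)) / real n) \<longlonglongrightarrow> \<Delta>2"
    and err_a: "(\<lambda>n. measure_pmf.prob (mabc_run m p1 p2 (msg_size n Ra) (msg_size n Rb) (C n))
                 {(wa, wb, wa', wb'). wa' \<noteq> wa}) \<longlonglongrightarrow> 0" (is "?ea \<longlonglongrightarrow> 0")
    and err_b: "(\<lambda>n. measure_pmf.prob (mabc_run m p1 p2 (msg_size n Ra) (msg_size n Rb) (C n))
                 {(wa, wb, wa', wb'). wb' \<noteq> wb}) \<longlonglongrightarrow> 0" (is "?eb \<longlonglongrightarrow> 0")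
    using assms(16) unfolding mabc_achievable_def by blast
  have "\<exists>(q :: nat pmf) pxa pxb px. set_pmf q \<subseteq> {..<?N} \<and>
     (\<forall>t. set_pmf (pxa t) \<subseteq> Xa \<and> set_pmf (pxb t) \<subseteq> Xb) \<and> set_pmf px \<subseteq> ?X \<and>
     (\<forall>S\<subseteq>{..<m}.
       (1 - ?ea n) * log 2 (real (msg_size n Ra)) - 1 \<le>
         real (c_n1 (C n)) * mac_info_a m S (phase1_dist q pxa pxb p1) +
         real (c_n2 (C n)) * bc_info_b m S (phase2_dist px p2) \<and>
       (1 - ?eb n) * log 2 (real (msg_size n Rb)) - 1 \<le>
         real (c_n1 (C n)) * mac_info_b m S (phase1_dist q pxa pxb p1) +
         real (c_n2 (C n)) * bc_info_a m S (phase2_dist px p2))" for n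
    by (rule code_single_letter[OF fin1 fin2 valid log_msg_size_bounds(3)[OF R(1)]
          log_msg_size_bounds(3)[OF R(2)]])
  then obtain q :: "nat \<Rightarrow> nat pmf" and pxa pxb px where q: "\<And>n. set_pmf (q n) \<subseteq> {..<?N}"
    and pxa: "\<And>n t. set_pmf (pxa n t) \<subseteq> Xa" and pxb: "\<And>n t. set_pmf (pxb n t) \<subseteq> Xb"
    and px: "\<And>n. set_pmf (px n) \<subseteq> ?X"
    and bound_a: "\<And>n S. S \<subseteq> {..<m} \<Longrightarrow> (1 - ?ea n) * log 2 (real (msg_size n Ra)) - 1 \<le>
         real (c_n1 (C n)) * mac_info_a m S (phase1_dist (q n) (pxa n) (pxb n) p1) +
         real (c_n2 (C n)) * bc_info_b m S (phase2_dist (px n) p2)"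
    and bound_b: "\<And>n S. S \<subseteq> {..<m} \<Longrightarrow> (1 - ?eb n) * log 2 (real (msg_size n Rb)) - 1 \<le>
         real (c_n1 (C n)) * mac_info_b m S (phase1_dist (q n) (pxa n) (pxb n) p1) +
         real (c_n2 (C n)) * bc_info_a m S (phase2_dist (px n) p2)"
    by metis

  \<comment> \<open>Subsequences are extracted for the factors \<open>q\<close>, \<open>pxa\<close>,
    \<open>pxb\<close>, \<open>px\<close>, not for the joint laws: a limit of joint laws would still
    have to be factored, whereas here \<open>phase1_dist Q A B p1\<close> has the required form by
    construction.\<close>
  obtain r1 Q where r1: "strict_mono (r1 :: nat \<Rightarrow> nat)" "pmf_tendsto (\<lambda>n. q (r1 n)) Q"
    using pmf_compact_single[of "{..<?N}" q] q by auto
  obtain r2 A where r2: "strict_mono (r2 :: nat \<Rightarrow> nat)"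
    "\<And>t. t < ?N \<Longrightarrow> pmf_tendsto (\<lambda>n. pxa (r1 (r2 n)) t) (A t)"
    using pmf_compact[of "{..<?N}" Xa "\<lambda>t n. pxa (r1 n) t"] pxa assms(1) by auto
  obtain r3 B where r3: "strict_mono (r3 :: nat \<Rightarrow> nat)"
    "\<And>t. t < ?N \<Longrightarrow> pmf_tendsto (\<lambda>n. pxb (r1 (r2 (r3 n))) t) (B t)"
    using pmf_compact[of "{..<?N}" Xb "\<lambda>t n. pxb (r1 (r2 n)) t"] pxb assms(3) by auto
  obtain r4 X where r4: "strict_mono (r4 :: nat \<Rightarrow> nat)" "pmf_tendsto (\<lambda>n. px (r1 (r2 (r3 (r4 n))))) X"
    using pmf_compact_single[of ?X "\<lambda>n. px (r1 (r2 (r3 n)))"] px finX by auto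
  define r where "r n = r1 (r2 (r3 (r4 n)))" for n
  have r: "strict_mono r"
    using r1(1) r2(1) r3(1) r4(1) by (simp add: r_def strict_mono_def)
  have lim_q: "pmf_tendsto (\<lambda>n. q (r n)) Q"
    using pmf_tendsto_subseq[OF r1(2) strict_mono_o[OF r2(1) strict_mono_o[OF r3(1) r4(1)]]]
    by (simp add: r_def)
  have lim_a: "pmf_tendsto (\<lambda>n. pxa (r n) t) (A t)" if "t < ?N" for t
    using pmf_tendsto_subseq[OF r2(2)[OF that] strict_mono_o[OF r3(1) r4(1)]] by (simp add: r_def)
  have lim_b: "pmf_tendsto (\<lambda>n. pxb (r n) t) (B t)" if "t < ?N" for t
    using pmf_tendsto_subseq[OF r3(2)[OF that] r4(1)] by (simp add: r_def)
  have lim_x: "pmf_tendsto (\<lambda>n. px (r n)) X"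
    using r4(2) by (simp add: r_def)

  let ?P = "\<lambda>n. phase1_dist (q (r n)) (pxa (r n)) (pxb (r n)) p1"
  let ?D = "\<lambda>n. phase2_dist (px (r n)) p2"
  have "\<And>n. set_pmf (?P n) \<subseteq> {..<?N} \<times> Xa \<times> Xb \<times> PiE {..<m} Yr"
    using q pxa pxb assms(11) by (fastforce simp: phase1_dist_def)
  note lim1 = cmi_tendsto[OF _ this phase1_dist_tendsto[OF assms(1,3) q lim_q pxa lim_a pxb lim_b]]
  have "\<And>n. set_pmf (?D n) \<subseteq> ?X \<times> Ya \<times> Yb"
    using px assms(12) by (fastforce simp: phase2_dist_def)
  note lim2 = cmi_tendsto[OF _ this phase2_dist_tendsto[OF finX px lim_x]]
  have lim_mac: "(\<lambda>n. mac_info_a m S (?P n)) \<longlonglongrightarrow> mac_info_a m S (phase1_dist Q A B p1)"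
    "(\<lambda>n. mac_info_b m S (?P n)) \<longlonglongrightarrow> mac_info_b m S (phase1_dist Q A B p1)" for S
    unfolding mac_info_a_def mac_info_b_def using assms(1,3) finY by (intro lim1; simp)+
  have lim_bc: "(\<lambda>n. bc_info_a m S (?D n)) \<longlonglongrightarrow> bc_info_a m S (phase2_dist X p2)"
    "(\<lambda>n. bc_info_b m S (?D n)) \<longlonglongrightarrow> bc_info_b m S (phase2_dist X p2)" for S
    unfolding bc_info_a_def bc_info_b_def using assms(7,9) finX by (intro lim2; simp)+

  have Q: "set_pmf Q \<subseteq> {..<?N}"
    by (rule pmf_tendsto_support[OF q lim_q])
  then have "finite (set_pmf Q)" "card (set_pmf Q) \<le> ?N"
    using card_mono[OF _ Q] by (auto intro: finite_subset)
  moreover have "set_pmf (A t) \<subseteq> Xa \<and> set_pmf (B t) \<subseteq> Xb" if "t \<in> set_pmf Q" for t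
    using pmf_tendsto_support[OF pxa lim_a] pmf_tendsto_support[OF pxb lim_b] Q that by blast
  moreover have "set_pmf X \<subseteq> ?X"
    by (rule pmf_tendsto_support[OF px lim_x])
  moreover have "Ra \<le> \<Delta>1 * mac_info_a m S (phase1_dist Q A B p1) + \<Delta>2 * bc_info_b m S (phase2_dist X p2)"
    if "S \<subseteq> {..<m}" for S
    by (rule rate_limit[OF R(1) err_a r n1 n2 lim_mac(1) lim_bc(2) bound_a[OF that]])
  moreover have "Rb \<le> \<Delta>1 * mac_info_b m S (phase1_dist Q A B p1) + \<Delta>2 * bc_info_a m S (phase2_dist X p2)"
    if "S \<subseteq> {..<m}" for S
    by (rule rate_limit[OF R(2) err_b r n1 n2 lim_mac(2) lim_bc(1) bound_b[OF that]])
  ultimately show ?thesis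
    unfolding mac_info_a_def mac_info_b_def bc_info_a_def bc_info_b_def
    by (intro exI[of _ Q] exI[of _ A] exI[of _ B] exI[of _ X]) simp
qed

end
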